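(* Let $J_n$ denote the number of distinct (as ordered trees) fringe subtrees of a random binary search tree with $n$ leaves. There are two constants $c_5 \approx 2.4071298335$ and $c_6 \approx 2.7725887222$ such that, as $n\to\infty$: (i) $\displaystyle c_5 \frac{n}{\ln n}(1+o(1)) \le \mathbb{E}(J_n) \le c_6 \frac{n}{\ln n}(1+o(1))$; (ii) with high probability, $\displaystyle c_5 \frac{n}{\ln n}(1+o(1)) \le J_n \le c_6 \frac{n}{\ln n}(1+o(1))$, i.e. for every fixed $\eta>0$, $\mathbb{P}\big((c_5-\eta)\frac{n}{\ln n} \le J_n \le (c_6+\eta)\frac{n}{\ln n}\big)\to 1$.
   Context: A binary tree is a rooted tree in which every node has either exactly two children or none; it is ordered if the children of each inner node are ordered. The size $|t|$ of a binary tree $t$ is its number of leaves. For a node $v$ of $t$, $t(v)$ denotes the fringe subtree rooted at $v$ (the node $v$ together with all its descendants). A random binary search tree with $n$ leaves is a random ordered binary tree with $n$ leaves distributed according to $P_{\mathrm{bst}}(t)=\prod_{v\in t,\ |t(v)|>1} \frac{1}{|t(v)|-1}$. Two fringe subtrees are distinct if they differ as ordered binary trees. "With high probability" means with probability tending to $1$ as $n\to\infty$. *)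

theory Defs
  imports
    "HOL-Probability.Probability"
    "HOL-Library.Tree"
    "HOL-Library.Multiset"
    "HOL-Library.Landau_Symbols"
begin

text \<open>
  An unlabelled ordered binary tree is a \<^typ>\<open>unit tree\<close>: a \<^const>\<open>Leaf\<close> is a node without
  children, a \<^const>\<open>Node\<close> is an inner node with a left and a right child. The size of \<open>t\<close>, its number
  of leaves, is \<^term>\<open>size1 t\<close>; beware that \<^term>\<open>size t\<close> is the number of inner nodes instead.
\<close>

text \<open>The multiset contains one element \<open>t(v)\<close> for every node \<open>v\<close> of \<open>t\<close>, leaves included.\<close>

primrec fringe_subtrees :: "'a tree \<Rightarrow> 'a tree multiset" where
  "fringe_subtrees Leaf = {#Leaf#}"
| "fringe_subtrees (Node l a r) = add_mset (Node l a r) (fringe_subtrees l + fringe_subtrees r)"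

definition num_distinct_fringe :: "unit tree \<Rightarrow> nat" where
  "num_distinct_fringe t = card (set_mset (fringe_subtrees t))"

definition P_bst :: "unit tree \<Rightarrow> real" where
  "P_bst t = (\<Prod>s\<in>#filter_mset (\<lambda>s. size1 s > 1) (fringe_subtrees t). 1 / (real (size1 s) - 1))"

text \<open>
  For \<open>n \<ge> 1\<close> the weights below sum to 1, so this is a genuine embedding; see \<open>pmf_random_bst\<close>.
  There is no tree of size 0, and \<open>random_bst 0\<close> carries no meaning.
\<close>

definition random_bst :: "nat \<Rightarrow> unit tree pmf" where
  "random_bst n = embed_pmf (\<lambda>t. if size1 t = n then P_bst t else 0)"

lemma set_mset_fringe_subtrees: "set_mset (fringe_subtrees t) = subtrees t"
  by (induction t) auto

lemma P_bst_Leaf [simp]: "P_bst Leaf = 1"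
  by (simp add: P_bst_def)

lemma P_bst_Node [simp]:
  "P_bst (Node l a r) = P_bst l * P_bst r / (real (size1 l + size1 r) - 1)"
proof -
  have "size1 l + size1 r > 1"
    using size1_ge0[of l] size1_ge0[of r] by linarith
  then show ?thesis
    by (simp add: P_bst_def)
qed

lemma P_bst_nonneg: "P_bst t \<ge> 0"
proof (induction t)
  case (Node l a r)
  have "real (size1 l + size1 r) - 1 \<ge> 0"
    using size1_ge0[of l] by linarith
  then show ?case
    using Node by (simp add: zero_le_divide_iff)
qed simp

lemma trees_of_size1_rec:
  fixes n :: nat
  assumes "n \<ge> 2"
  shows "{t :: unit tree. size1 t = n} =
    (\<lambda>(k, l, r). Node l () r) `
      (SIGMA k:{1..<n}. {t. size1 t = k} \<times> {t. size1 t = n - k})" (is "?A = ?B")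
proof
  show "?A \<subseteq> ?B"
  proof
    fix t :: "unit tree"
    assume t: "t \<in> ?A"
    with assms obtain l r where lr: "t = Node l () r"
      by (cases t) auto
    have "(size1 l, l, r) \<in> (SIGMA k:{1..<n}. {t. size1 t = k} \<times> {t. size1 t = n - k})"
      using t lr size1_ge0[of l] size1_ge0[of r]
      by (auto simp: Suc_le_eq simp del: size1_ge0)
    then show "t \<in> ?B"
      unfolding lr by (rule rev_image_eqI) simp
  qed
qed auto

lemma finite_trees_of_size1: "finite {t :: unit tree. size1 t = n}"
proof (induction n rule: less_induct)
  case (less n)
  consider "n = 0" | "n = 1" | "n \<ge> 2" by linarith
  then show ?case
  proof cases
    case 1
    then have "{t :: unit tree. size1 t = n} = {}" by (auto simp: size1_size)
    then show ?thesis by simp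
  next
    case 2
    then have "{t :: unit tree. size1 t = n} = {Leaf}" by (auto simp: size1_size)
    then show ?thesis by simp
  next
    case 3
    show ?thesis
      unfolding trees_of_size1_rec[OF 3]
      by (intro finite_imageI finite_SigmaI finite_cartesian_product less) auto
  qed
qed

lemma sum_P_bst:
  assumes "n \<ge> 1"
  shows "(\<Sum>t | size1 t = n. P_bst t) = 1"
  using assms
proof (induction n rule: less_induct)
  case (less n)
  show ?case
  proof (cases "n = 1")
    case True
    then have "{t :: unit tree. size1 t = n} = {Leaf}" by (auto simp: size1_size)
    then show ?thesis by simp
  next
    case False
    with less.prems have n: "n \<ge> 2" by simp
    let ?T = "\<lambda>k. {t :: unit tree. size1 t = k}"
    have inj: "inj_on (\<lambda>(k, l, r). Node l () r) (SIGMA k:{1..<n}. ?T k \<times> ?T (n - k))"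
      by (auto simp: inj_on_def)
    have "(\<Sum>t\<in>?T n. P_bst t) =
        (\<Sum>(k, l, r)\<in>(SIGMA k:{1..<n}. ?T k \<times> ?T (n - k)). P_bst (Node l () r))"
      unfolding trees_of_size1_rec[OF n]
      by (subst sum.reindex[OF inj]) (simp add: case_prod_unfold)
    also have "\<dots> = (\<Sum>(k, l, r)\<in>(SIGMA k:{1..<n}. ?T k \<times> ?T (n - k)).
        P_bst l * P_bst r / (real n - 1))"
      by (intro sum.cong refl) auto
    also have "\<dots> = (\<Sum>k\<in>{1..<n}. \<Sum>(l, r)\<in>?T k \<times> ?T (n - k). P_bst l * P_bst r / (real n - 1))"
      by (subst sum.Sigma [symmetric]) (auto intro!: finite_cartesian_product finite_trees_of_size1)
    also have "\<dots> = (\<Sum>k\<in>{1..<n}. (\<Sum>l\<in>?T k. P_bst l) * (\<Sum>r\<in>?T (n - k). P_bst r) / (real n - 1))"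
      by (intro sum.cong refl)
        (simp add: sum_product sum.cartesian_product sum_divide_distrib case_prod_unfold)
    also have "\<dots> = (\<Sum>k\<in>{1..<n}. 1 / (real n - 1))"
      using less.IH by (intro sum.cong refl) auto
    also have "\<dots> = 1"
      using n by (simp add: of_nat_diff)
    finally show ?thesis .
  qed
qed

lemma pmf_random_bst:
  assumes "n \<ge> 1"
  shows "pmf (random_bst n) t = (if size1 t = n then P_bst t else 0)"
  unfolding random_bst_def
proof (rule pmf_embed_pmf)
  have "(\<integral>\<^sup>+ t. ennreal (if size1 t = n then P_bst t else 0) \<partial>count_space UNIV)
      = (\<integral>\<^sup>+ t. ennreal (P_bst t) \<partial>count_space {t. size1 t = n})"
    by (subst nn_integral_count_space_indicator)
      (auto intro!: nn_integral_cong simp: indicator_def)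
  also have "\<dots> = ennreal (\<Sum>t | size1 t = n. P_bst t)"
    by (simp add: nn_integral_count_space_finite finite_trees_of_size1 P_bst_nonneg)
  also have "\<dots> = 1"
    using sum_P_bst[OF assms] by simp
  finally show "(\<integral>\<^sup>+ t. ennreal (if size1 t = n then P_bst t else 0) \<partial>count_space UNIV) = 1" .
qed (simp add: P_bst_nonneg)

end

theory Submission
  imports
    Defs
    "HOL-Real_Asymp.Real_Asymp"
begin

text \<open>
  Cut at size \<open>K\<close>. The number of fringe subtrees with at least \<open>K\<close> leaves has mean \<open>2 n / K - 1\<close>
  and a variance of the same order, hence is concentrated. There are at most \<open>4 ^ K\<close> smaller trees, so
  \<open>K\<close> slightly below \<open>ln n / ln 4\<close> gives the upper bound \<open>2 n ln 4 / ln n\<close>.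

  For the lower bound, \<open>- ln (P_bst t)\<close> is an additive functional of \<open>t\<close> with mean about \<open>h n\<close>, where
  \<open>h = 2 * (\<Sum>j. ln j / ((j + 1) * (j + 2)))\<close> is the entropy rate. Truncating its toll function at a
  size \<open>M\<close> only decreases the functional and makes its mean exactly linear for \<open>n > M\<close>, so its variance
  is \<open>O(n)\<close> and \<open>P_bst t \<le> exp (- h' n)\<close> with high probability for every \<open>h' < h\<close>. With \<open>K\<close> slightly
  above \<open>ln n / h\<close>, therefore almost all fringe subtrees with at least \<open>K\<close> leaves are this unlikely, and
  a second moment computation shows that only \<open>o(n / ln n)\<close> pairs of those coincide. This gives the
  lower bound \<open>2 h n / ln n\<close>.
\<close>

section \<open>The entropy constant\<close>

text \<open>The series \<open>ln y = 2 * artanh ((y - 1) / (y + 1))\<close> has positive terms for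
  \<open>y > 1\<close>, so its partial sums are lower bounds. At \<open>y = 1 + 1 / x\<close> the
  argument is \<open>1 / (2 * x + 1)\<close>.\<close>

lemma ln_one_plus_inverse_ge:
  fixes x :: real
  assumes "x > 0"
  shows "(\<Sum>k<n. 2 / (real (2 * k + 1) * (2 * x + 1) ^ (2 * k + 1))) \<le> ln (1 + 1 / x)"
proof -
  have "(1 + 1 / x - 1) / (1 + 1 / x + 1) = 1 / (2 * x + 1)"
    using assms by (simp add: field_simps)
  then show ?thesis
    using ln_approx_bounds[of "1 + 1 / x" n] assms
    by (simp add: power_divide mult.commute)
qed

text \<open>Inverse factorials behave under differences like negative powers under derivatives:
  \<open>pochhammer a p\<close> and \<open>pochhammer (a + 1) p\<close> are both
  \<open>pochhammer a (Suc p)\<close> without one of its end factors.\<close>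

lemma inverse_pochhammer_diff:
  fixes a :: real
  assumes "a > 0"
  shows "1 / pochhammer a p - 1 / pochhammer (a + 1) p = real p / pochhammer a (Suc p)"
proof -
  have pos: "pochhammer a p > 0" "pochhammer (a + 1) p > 0"
    using assms by (simp_all add: pochhammer_pos)
  have "a * pochhammer (a + 1) p = pochhammer a p * (a + real p)"
    by (metis pochhammer_Suc pochhammer_rec)
  moreover have nz: "a + real p > 0"
    using assms by simp
  ultimately have "1 / pochhammer (a + 1) p = a / (pochhammer a p * (a + real p))"
    using assms pos by (simp add: divide_simps)
  moreover have "1 / pochhammer a p = (a + real p) / (pochhammer a p * (a + real p))"
    using nz by simp
  ultimately have "1 / pochhammer a p - 1 / pochhammer (a + 1) p =
      (a + real p) / (pochhammer a p * (a + real p)) - a / (pochhammer a p * (a + real p))"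
    by metis
  also have "\<dots> = real p / (pochhammer a p * (a + real p))"
    by (simp only: diff_divide_distrib [symmetric] add_diff_cancel_left')
  finally show ?thesis
    by (simp only: pochhammer_Suc)
qed

text \<open>
  The sum over \<open>i \<ge> x\<close> of \<open>ln (1 + 1 / i) / (i + 2)\<close>, with the logarithm replaced by its lower bound
  \<open>ln_one_plus_inverse_ge\<close> for \<open>n = 3\<close>, has an expansion in the inverse factorials
  \<open>1 / pochhammer (x - 3) (p + 1)\<close>, whose differences in \<open>x\<close> are again inverse factorials. The coefficients
  below are its first eight.
\<close>

definition tail_coeff :: "real list" where
  "tail_coeff = [1, -15/4, 94/9, -917/48, 5087/300, 3/8, 1051/1344, 2421/1024]"

definition ln_sum_tail :: "real \<Rightarrow> real" where
  "ln_sum_tail x = (\<Sum>p<8. tail_coeff ! p / pochhammer (x - 3) (Suc p))"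

text \<open>Summed over \<open>x\<close>, this telescopes and bounds the tail of the series from
  below. Nine consecutive factors serve as common denominator, which leaves a polynomial
  inequality.\<close>

lemma ln_sum_tail_diff:
  assumes x: "x \<ge> 24"
  shows "ln_sum_tail x - ln_sum_tail (x + 1) \<le> ln (1 + 1 / x) / (x + 2)"
proof -
  have "ln_sum_tail x - ln_sum_tail (x + 1)
      = (\<Sum>p<8. tail_coeff ! p * (1 / pochhammer (x - 3) (Suc p) - 1 / pochhammer (x - 3 + 1) (Suc p)))"
    by (simp add: ln_sum_tail_def sum_subtractf right_diff_distrib algebra_simps)
  also have "\<dots> = (\<Sum>p<8. tail_coeff ! p * real (Suc p) / pochhammer (x - 3) (Suc (Suc p)))"
    using x by (intro sum.cong refl) (subst inverse_pochhammer_diff, simp_all)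
  also have "\<dots> = (\<Sum>p<8. tail_coeff ! p * real (Suc p) *
      (\<Prod>r=p+2..<9. x - 3 + real r)) / (\<Prod>r<9. x - 3 + real r)"
    unfolding sum_divide_distrib
  proof (intro sum.cong refl)
    fix p :: nat assume "p \<in> {..<8}"
    then have "(\<Prod>r<9. x - 3 + real r) = pochhammer (x - 3) (Suc (Suc p)) * (\<Prod>r=p+2..<9. x - 3 + real r)"
      unfolding pochhammer_prod lessThan_atLeast0
      using prod.atLeastLessThan_concat[of 0 "p + 2" 9 "\<lambda>r. x - 3 + real r"] by simp
    moreover have "(\<Prod>r=p+2..<9. x - 3 + real r) \<noteq> 0"
      using x by simp
    ultimately show "tail_coeff ! p * real (Suc p) / pochhammer (x - 3) (Suc (Suc p)) =
        tail_coeff ! p * real (Suc p) * (\<Prod>r=p+2..<9. x - 3 + real r) / (\<Prod>r<9. x - 3 + real r)"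
      by simp
  qed
  also have "\<dots> \<le> (\<Sum>k<3. 2 / (real (2 * k + 1) * (2 * x + 1) ^ (2 * k + 1))) / (x + 2)"
  proof -
    define z where "z = x - 24"
    have z: "z \<ge> 0" and xz: "x = z + 24" using x by (auto simp: z_def)
    define N where "N = (\<Sum>p<8. tail_coeff ! p * real (Suc p) * (\<Prod>r=p+2..<9. x - 3 + real r))"
    \<comment> \<open>The factor \<open>z + 26\<close> is left out of the nine because it equals the
      denominator \<open>x + 2\<close> on the other side.\<close>
    define R where "R = (z + 21) * (z + 22) * (z + 23) * (z + 24) * (z + 25) * (z + 27) * (z + 28) * (z + 29)"
    define w where "w = 2 * z + 49"
    have R: "R > 0" and w: "w > 0" using z by (simp_all add: R_def w_def)
    have Q: "(\<Prod>r<9. x - 3 + real r) = R * (z + 26)"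
      by (simp add: eval_nat_numeral R_def xz ac_simps)
    have N: "N = (z+23)*(z+24)*(z+25)*(z+26)*(z+27)*(z+28)*(z+29)
        - 15/2*(z+24)*(z+25)*(z+26)*(z+27)*(z+28)*(z+29) + 94/3*(z+25)*(z+26)*(z+27)*(z+28)*(z+29)
        - 917/12*(z+26)*(z+27)*(z+28)*(z+29) + 5087/60*(z+27)*(z+28)*(z+29) + 9/4*(z+28)*(z+29)
        + 1051/192*(z+29) + 2421/128"
      by (simp add: N_def xz tail_coeff_def eval_nat_numeral prod.atLeast_Suc_lessThan) algebra
    \<comment> \<open>The terms of degree 12 down to 5 cancel, eight conditions met by the eight
      entries of \<open>tail_coeff\<close>. After the shift by 24 all remaining coefficients are
      positive.\<close>
    have "2 * (w ^ 4 + w ^ 2 / 3 + 1 / 5) * R - N * w ^ 5 =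
        1869856656031 / 1920 + 38166994789 / 240 * z + 1558126609 / 160 * z ^ 2
        + 15902401 / 60 * z ^ 3 + 324607 / 120 * z ^ 4"
      unfolding N R_def w_def by algebra
    also have "\<dots> \<ge> 0" using z by simp
    finally have "N * w ^ 5 \<le> 2 * (w ^ 4 + w ^ 2 / 3 + 1 / 5) * R" by simp
    then have "N / R \<le> 2 * (w ^ 4 + w ^ 2 / 3 + 1 / 5) / w ^ 5"
      using R w by (simp add: field_simps)
    also have "\<dots> = (\<Sum>k<3. 2 / (real (2 * k + 1) * (2 * x + 1) ^ (2 * k + 1)))"
    proof -
      have "2 * x + 1 = w" by (simp add: w_def xz)
      then show ?thesis
        using w by (simp add: eval_nat_numeral field_simps)
    qed
    finally have "N / R / (x + 2) \<le> (\<Sum>k<3. 2 / (real (2 * k + 1) * (2 * x + 1) ^ (2 * k + 1))) / (x + 2)"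
      using x by (intro divide_right_mono) auto
    then show ?thesis
      unfolding Q N_def[symmetric] by (simp add: xz add.commute)
  qed
  also have "\<dots> \<le> ln (1 + 1 / x) / (x + 2)"
    using x by (intro divide_right_mono ln_one_plus_inverse_ge) auto
  finally show ?thesis .
qed

text \<open>Each logarithm is bounded below by a decimal with 14 places, from as many series terms
  as this precision takes. The rest is rational arithmetic.\<close>

lemma ln_sum_initial_segment:
  "(\<Sum>i=1..<24. ln (1 + 1 / real i) / (real i + 2)) \<ge> 5613696290184 / 10^13"
proof -
  have l1: "ln (1 + 1 / 1) \<ge> (69314718055993 / 10^14 :: real)"
    by (rule order_trans[OF _ ln_one_plus_inverse_ge[of "1" 13]]) (simp_all add: eval_nat_numeral)
  have l2: "ln (1 + 1 / 2) \<ge> (40546510810815 / 10^14 :: real)"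
    by (rule order_trans[OF _ ln_one_plus_inverse_ge[of "2" 9]]) (simp_all add: eval_nat_numeral)
  have l3: "ln (1 + 1 / 3) \<ge> (28768207245175 / 10^14 :: real)"
    by (rule order_trans[OF _ ln_one_plus_inverse_ge[of "3" 7]]) (simp_all add: eval_nat_numeral)
  have l4: "ln (1 + 1 / 4) \<ge> (22314355131420 / 10^14 :: real)"
    by (rule order_trans[OF _ ln_one_plus_inverse_ge[of "4" 7]]) (simp_all add: eval_nat_numeral)
  have l5: "ln (1 + 1 / 5) \<ge> (18232155679395 / 10^14 :: real)"
    by (rule order_trans[OF _ ln_one_plus_inverse_ge[of "5" 6]]) (simp_all add: eval_nat_numeral)
  have l6: "ln (1 + 1 / 6) \<ge> (15415067982725 / 10^14 :: real)"
    by (rule order_trans[OF _ ln_one_plus_inverse_ge[of "6" 6]]) (simp_all add: eval_nat_numeral)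
  have l7: "ln (1 + 1 / 7) \<ge> (13353139262450 / 10^14 :: real)"
    by (rule order_trans[OF _ ln_one_plus_inverse_ge[of "7" 5]]) (simp_all add: eval_nat_numeral)
  have l8: "ln (1 + 1 / 8) \<ge> (11778303565637 / 10^14 :: real)"
    by (rule order_trans[OF _ ln_one_plus_inverse_ge[of "8" 5]]) (simp_all add: eval_nat_numeral)
  have l9: "ln (1 + 1 / 9) \<ge> (10536051565782 / 10^14 :: real)"
    by (rule order_trans[OF _ ln_one_plus_inverse_ge[of "9" 5]]) (simp_all add: eval_nat_numeral)
  have l10: "ln (1 + 1 / 10) \<ge> (9531017980432 / 10^14 :: real)"
    by (rule order_trans[OF _ ln_one_plus_inverse_ge[of "10" 5]]) (simp_all add: eval_nat_numeral)
  have l11: "ln (1 + 1 / 11) \<ge> (8701137698962 / 10^14 :: real)"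
    by (rule order_trans[OF _ ln_one_plus_inverse_ge[of "11" 5]]) (simp_all add: eval_nat_numeral)
  have l12: "ln (1 + 1 / 12) \<ge> (8004270767353 / 10^14 :: real)"
    by (rule order_trans[OF _ ln_one_plus_inverse_ge[of "12" 5]]) (simp_all add: eval_nat_numeral)
  have l13: "ln (1 + 1 / 13) \<ge> (7410797215369 / 10^14 :: real)"
    by (rule order_trans[OF _ ln_one_plus_inverse_ge[of "13" 4]]) (simp_all add: eval_nat_numeral)
  have l14: "ln (1 + 1 / 14) \<ge> (6899287148693 / 10^14 :: real)"
    by (rule order_trans[OF _ ln_one_plus_inverse_ge[of "14" 4]]) (simp_all add: eval_nat_numeral)
  have l15: "ln (1 + 1 / 15) \<ge> (6453852113756 / 10^14 :: real)"
    by (rule order_trans[OF _ ln_one_plus_inverse_ge[of "15" 4]]) (simp_all add: eval_nat_numeral)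
  have l16: "ln (1 + 1 / 16) \<ge> (6062462181643 / 10^14 :: real)"
    by (rule order_trans[OF _ ln_one_plus_inverse_ge[of "16" 4]]) (simp_all add: eval_nat_numeral)
  have l17: "ln (1 + 1 / 17) \<ge> (5715841383994 / 10^14 :: real)"
    by (rule order_trans[OF _ ln_one_plus_inverse_ge[of "17" 4]]) (simp_all add: eval_nat_numeral)
  have l18: "ln (1 + 1 / 18) \<ge> (5406722127027 / 10^14 :: real)"
    by (rule order_trans[OF _ ln_one_plus_inverse_ge[of "18" 4]]) (simp_all add: eval_nat_numeral)
  have l19: "ln (1 + 1 / 19) \<ge> (5129329438754 / 10^14 :: real)"
    by (rule order_trans[OF _ ln_one_plus_inverse_ge[of "19" 4]]) (simp_all add: eval_nat_numeral)
  have l20: "ln (1 + 1 / 20) \<ge> (4879016416943 / 10^14 :: real)"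
    by (rule order_trans[OF _ ln_one_plus_inverse_ge[of "20" 4]]) (simp_all add: eval_nat_numeral)
  have l21: "ln (1 + 1 / 21) \<ge> (4652001563489 / 10^14 :: real)"
    by (rule order_trans[OF _ ln_one_plus_inverse_ge[of "21" 4]]) (simp_all add: eval_nat_numeral)
  have l22: "ln (1 + 1 / 22) \<ge> (4445176257083 / 10^14 :: real)"
    by (rule order_trans[OF _ ln_one_plus_inverse_ge[of "22" 4]]) (simp_all add: eval_nat_numeral)
  have l23: "ln (1 + 1 / 23) \<ge> (4255961441879 / 10^14 :: real)"
    by (rule order_trans[OF _ ln_one_plus_inverse_ge[of "23" 4]]) (simp_all add: eval_nat_numeral)
  have "{1..<24::nat} = {1,2,3,4,5,6,7,8,9,10,11,12,13,14,15,16,17,18,19,20,21,22,23}" by code_simp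
  then show ?thesis using l1 l2 l3 l4 l5 l6 l7 l8 l9 l10 l11 l12 l13 l14 l15 l16 l17 l18 l19 l20 l21 l22 l23 by simp
qed

lemma ln_sum_tail_tendsto: "((\<lambda>m. ln_sum_tail (real m + 1)) \<longlongrightarrow> 0) sequentially"
  unfolding ln_sum_tail_def tail_coeff_def
  by (simp add: eval_nat_numeral pochhammer_Suc) real_asymp

text \<open>The first 23 terms are estimated numerically, the later ones by the telescoping
  differences of \<open>ln_sum_tail\<close>.\<close>

lemma ln_sum_ge:
  assumes "m \<ge> 23"
  shows "(\<Sum>i=1..m. ln (1 + 1 / real i) / (real i + 2)) \<ge>
    5613696290184 / 10^13 + ln_sum_tail 24 - ln_sum_tail (real m + 1)"
  using assms
proof (induction m rule: dec_induct)
  case base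
  have "{1..23::nat} = {1..<24}" by auto
  then show ?case using ln_sum_initial_segment by simp
next
  case (step m)
  then show ?case
    using ln_sum_tail_diff[of "real m + 1"] by (simp add: add_ac)
qed

text \<open>The truncated subtraction makes the term for \<open>k = 1\<close> vanish, since \<open>ln 0 = 0\<close>.\<close>

definition truncated_entropy :: "nat \<Rightarrow> real" where
  "truncated_entropy M = (\<Sum>k=1..M. 2 * ln (real (k - 1)) / (real k * (real k + 1)))"

text \<open>Summation by parts with \<open>1 / (k * (k + 1)) = 1 / k - 1 / (k + 1)\<close>; the last
  term is the boundary term, which tends to 0.\<close>

lemma truncated_entropy_eq:
  "truncated_entropy (m + 2) =
    2 * (\<Sum>i=1..m. ln (1 + 1 / real i) / (real i + 2)) - 2 * ln (real m + 1) / (real m + 3)"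
proof (induction m)
  case 0
  show ?case by (simp add: truncated_entropy_def eval_nat_numeral)
next
  case (Suc m)
  have "ln (1 + 1 / real (Suc m)) = ln (real m + 2) - ln (real m + 1)"
  proof -
    have "1 + 1 / real (Suc m) = (real m + 2) / (real m + 1)"
      by (simp add: field_simps)
    then show ?thesis by (simp add: ln_div)
  qed
  moreover have "truncated_entropy (Suc m + 2) = truncated_entropy (m + 2) +
      2 * ln (real m + 2) / ((real m + 3) * (real m + 4))"
    by (simp add: truncated_entropy_def add_ac)
  moreover have "2 * ln (real m + 2) / ((real m + 3) * (real m + 4)) =
      2 * ln (real m + 2) / (real m + 3) - 2 * ln (real m + 2) / (real m + 4)"
    by (simp add: field_simps)
  ultimately show ?case
    using Suc by (simp add: add_ac diff_divide_distrib right_diff_distrib)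
qed

text \<open>Here \<open>2.40712983345\<close> is \<open>2.4071298335 - 5 / 10 ^ 11\<close>, the
  lower end of the interval allowed for \<open>c5\<close>. The lower bounds on the partial sums have
  a limit above half of it, so a finite \<open>M\<close> suffices.\<close>

lemma truncated_entropy_gt: "\<exists>M. truncated_entropy M > 2.40712983345 / 2"
proof -
  let ?c = "5613696290184 / 10^13 + ln_sum_tail 24"
  have "((\<lambda>m. 2 * (?c - ln_sum_tail (real m + 1)) - 2 * ln (real m + 1) / (real m + 3))
      \<longlongrightarrow> 2 * (?c - 0) - 0) sequentially"
    by (intro tendsto_intros ln_sum_tail_tendsto) real_asymp
  moreover have "2 * (?c - 0) - 0 > 2.40712983345 / 2"
    by (simp add: ln_sum_tail_def tail_coeff_def eval_nat_numeral pochhammer_Suc)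
  ultimately have "\<forall>\<^sub>F m in sequentially. 2.40712983345 / 2 <
      2 * (?c - ln_sum_tail (real m + 1)) - 2 * ln (real m + 1) / (real m + 3)"
    by (rule order_tendstoD)
  moreover have "\<forall>\<^sub>F m in sequentially. m \<ge> (23::nat)"
    by (rule eventually_ge_at_top)
  ultimately have "\<forall>\<^sub>F m in sequentially. 2.40712983345 / 2 <
      2 * (?c - ln_sum_tail (real m + 1)) - 2 * ln (real m + 1) / (real m + 3) \<and> m \<ge> 23"
    by (rule eventually_conj)
  then obtain m where m: "m \<ge> 23" "2.40712983345 / 2 <
      2 * (?c - ln_sum_tail (real m + 1)) - 2 * ln (real m + 1) / (real m + 3)"
    using eventually_happens'[OF sequentially_bot] by blast
  then have "2.40712983345 / 2 < truncated_entropy (m + 2)"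
    using ln_sum_ge[OF m(1)] unfolding truncated_entropy_eq by argo
  then show ?thesis ..
qed

text \<open>The right-hand side is \<open>2.7725887222 + 5 / 10 ^ 11\<close>, the upper end of the
  interval allowed for \<open>c6\<close>.\<close>

lemma four_ln_2_less: "4 * ln 2 < (2.77258872225 :: real)"
  using ln_approx_bounds[of 2 12] by (simp add: eval_nat_numeral)

section \<open>Expectations over random binary search trees\<close>

text \<open>A finite sum in place of an integral, so that linearity and the split at the root are
  manipulations of sums. For \<open>n = 0\<close> the sum is empty and the value is 0.\<close>

definition bst_mean :: "nat \<Rightarrow> (unit tree \<Rightarrow> real) \<Rightarrow> real" where
  "bst_mean n g = (\<Sum>t | size1 t = n. P_bst t * g t)"

lemma expectation_random_bst:
  assumes "n \<ge> 1"
  shows "measure_pmf.expectation (random_bst n) g = bst_mean n g"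
proof -
  have "measure_pmf.expectation (random_bst n) g = (\<Sum>t | size1 t = n. g t * pmf (random_bst n) t)"
    using assms
    by (intro integral_measure_pmf_real finite_trees_of_size1)
      (auto simp: set_pmf_eq pmf_random_bst split: if_splits)
  then show ?thesis
    using assms by (simp add: bst_mean_def pmf_random_bst mult.commute)
qed

lemma prob_random_bst:
  assumes "n \<ge> 1"
  shows "measure_pmf.prob (random_bst n) {t. P t} = bst_mean n (\<lambda>t. of_bool (P t))"
proof -
  have "measure_pmf.prob (random_bst n) {t. P t} =
      measure_pmf.expectation (random_bst n) (indicator {t. P t})"
    by simp
  also have "\<dots> = bst_mean n (\<lambda>t. of_bool (P t))"
    unfolding expectation_random_bst[OF assms]
    by (simp add: bst_mean_def indicator_def)
  finally show ?thesis .
qed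

lemma bst_mean_cong:
  "(\<And>t. size1 t = n \<Longrightarrow> g t = h t) \<Longrightarrow> bst_mean n g = bst_mean n h"
  unfolding bst_mean_def by (intro sum.cong) auto

lemma bst_mean_mono:
  "(\<And>t. size1 t = n \<Longrightarrow> g t \<le> h t) \<Longrightarrow> bst_mean n g \<le> bst_mean n h"
  unfolding bst_mean_def by (intro sum_mono mult_left_mono P_bst_nonneg) auto

lemma bst_mean_nonneg:
  "(\<And>t. size1 t = n \<Longrightarrow> g t \<ge> 0) \<Longrightarrow> bst_mean n g \<ge> 0"
  unfolding bst_mean_def by (intro sum_nonneg mult_nonneg_nonneg P_bst_nonneg) auto

lemma bst_mean_add: "bst_mean n (\<lambda>t. g t + h t) = bst_mean n g + bst_mean n h"
  by (simp add: bst_mean_def distrib_left sum.distrib)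

lemma bst_mean_diff: "bst_mean n (\<lambda>t. g t - h t) = bst_mean n g - bst_mean n h"
  by (simp add: bst_mean_def right_diff_distrib sum_subtractf)

lemma bst_mean_cmult: "bst_mean n (\<lambda>t. c * g t) = c * bst_mean n g"
  by (simp add: bst_mean_def sum_distrib_left mult_ac)

lemma bst_mean_divide: "bst_mean n (\<lambda>t. g t / c) = bst_mean n g / c"
  by (simp add: bst_mean_def sum_divide_distrib)

lemma bst_mean_sum: "bst_mean n (\<lambda>t. \<Sum>x\<in>A. g x t) = (\<Sum>x\<in>A. bst_mean n (g x))"
  unfolding bst_mean_def by (subst sum.swap) (simp add: sum_distrib_left)

lemma bst_mean_const: "n \<ge> 1 \<Longrightarrow> bst_mean n (\<lambda>t. c) = c"
  using sum_P_bst[of n] by (simp add: bst_mean_def flip: sum_distrib_right)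

lemma bst_mean_1: "bst_mean 1 g = g Leaf"
proof -
  have "{t :: unit tree. size1 t = 1} = {Leaf}" by (auto simp: size1_size)
  then show ?thesis by (simp add: bst_mean_def)
qed

text \<open>The size of the left subtree is uniform on \<open>{1..<n}\<close>, and given this size
  the two subtrees are independent random binary search trees.\<close>

lemma bst_mean_rec:
  assumes n: "n \<ge> 2"
  shows "bst_mean n g =
    (\<Sum>k=1..<n. bst_mean k (\<lambda>l. bst_mean (n - k) (\<lambda>r. g (Node l () r)))) / (real n - 1)"
proof -
  let ?T = "\<lambda>k. {t :: unit tree. size1 t = k}"
  have inj: "inj_on (\<lambda>(k, l, r). Node l () r) (SIGMA k:{1..<n}. ?T k \<times> ?T (n - k))"
    by (auto simp: inj_on_def)
  have "bst_mean n g = (\<Sum>(k, l, r)\<in>(SIGMA k:{1..<n}. ?T k \<times> ?T (n - k)).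
      P_bst (Node l () r) * g (Node l () r))"
    unfolding bst_mean_def trees_of_size1_rec[OF n]
    by (subst sum.reindex[OF inj]) (simp add: case_prod_unfold)
  also have "\<dots> = (\<Sum>(k, l, r)\<in>(SIGMA k:{1..<n}. ?T k \<times> ?T (n - k)).
      P_bst l * (P_bst r * g (Node l () r)) / (real n - 1))"
    by (intro sum.cong refl) auto
  also have "\<dots> = (\<Sum>k\<in>{1..<n}. \<Sum>(l, r)\<in>?T k \<times> ?T (n - k).
      P_bst l * (P_bst r * g (Node l () r)) / (real n - 1))"
    by (subst sum.Sigma [symmetric]) (auto intro!: finite_cartesian_product finite_trees_of_size1)
  also have "\<dots> = (\<Sum>k=1..<n. bst_mean k (\<lambda>l. bst_mean (n - k) (\<lambda>r. g (Node l () r)))) / (real n - 1)"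
    by (simp add: bst_mean_def sum_distrib_left sum.cartesian_product sum_divide_distrib case_prod_unfold)
  finally show ?thesis .
qed

lemma bst_mean_Markov:
  assumes "\<And>t. size1 t = n \<Longrightarrow> g t \<ge> 0" "a > 0"
  shows "bst_mean n (\<lambda>t. of_bool (g t \<ge> a)) \<le> bst_mean n g / a"
  unfolding bst_mean_divide [symmetric] using assms
  by (intro bst_mean_mono) (auto simp: of_bool_def)

lemma bst_mean_Chebyshev:
  assumes "a > 0"
  shows "bst_mean n (\<lambda>t. of_bool (\<bar>g t\<bar> \<ge> a)) \<le> bst_mean n (\<lambda>t. g t ^ 2) / a ^ 2"
proof -
  have "(\<bar>g t\<bar> \<ge> a) = (g t ^ 2 \<ge> a ^ 2)" for t
    using assms abs_le_square_iff[of a "g t"] by simp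
  then show ?thesis
    using bst_mean_Markov[of n "\<lambda>t. g t ^ 2" "a ^ 2"] assms by simp
qed

section \<open>Additive functionals with toll function \<open>f\<close>: mean and variance\<close>

definition fringe_sum :: "(unit tree \<Rightarrow> real) \<Rightarrow> unit tree \<Rightarrow> real" where
  "fringe_sum f t = (\<Sum>s\<in>#fringe_subtrees t. f s)"

lemma fringe_sum_simps [simp]:
  "fringe_sum f Leaf = f Leaf"
  "fringe_sum f (Node l a r) = f (Node l a r) + fringe_sum f l + fringe_sum f r"
  by (simp_all add: fringe_sum_def)

lemma fringe_sum_mono:
  "(\<And>s. f s \<le> g s) \<Longrightarrow> fringe_sum f t \<le> fringe_sum g t"
  by (induction t) (auto intro!: add_mono)

lemma fringe_sum_nonneg:
  "(\<And>s. f s \<ge> 0) \<Longrightarrow> fringe_sum f t \<ge> 0"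
  by (induction t) (auto intro!: add_nonneg_nonneg)

lemma fringe_sum_diff: "fringe_sum (\<lambda>s. f s - g s) t = fringe_sum f t - fringe_sum g t"
  by (induction t) auto

lemma fringe_sum_sum: "fringe_sum (\<lambda>s. \<Sum>x\<in>A. f x s) t = (\<Sum>x\<in>A. fringe_sum (f x) t)"
  by (induction t) (auto simp: sum.distrib)

text \<open>
  The closed form of the solution of \<open>\<mu> n = e n + 2 / (n - 1) * (\<Sum>k=1..<n. \<mu> k)\<close>, the recurrence for the
  means of an additive functional with expected toll \<open>e\<close>.
\<close>

definition additive_mean :: "(nat \<Rightarrow> real) \<Rightarrow> nat \<Rightarrow> real" where
  "additive_mean e n = e n + (\<Sum>k=1..<n. 2 * real n * e k / (real k * (real k + 1)))"

lemma additive_mean_1 [simp]: "additive_mean e 1 = e 1" "additive_mean e (Suc 0) = e (Suc 0)"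
  by (simp_all add: additive_mean_def)

text \<open>This is the recurrence multiplied by \<open>n - 1\<close>, a form that holds at
  \<open>n = 1\<close> too and suits induction.\<close>

lemma sum_additive_mean:
  assumes "n \<ge> 1"
  shows "2 * (\<Sum>k=1..<n. additive_mean e k) = (real n - 1) * (additive_mean e n - e n)"
  using assms
proof (induction n rule: dec_induct)
  case base
  show ?case by simp
next
  case (step n)
  \<comment> \<open>\<open>S\<close> is the part of the closed form that \<open>n\<close> and
    \<open>Suc n\<close> share; the latter adds only the term for \<open>k = n\<close>.\<close>
  define S where "S = (\<Sum>k=1..<n. 2 * e k / (real k * (real k + 1)))"
  have m: "additive_mean e n = e n + real n * S"
    by (simp add: additive_mean_def S_def sum_distrib_left mult_ac)
  have "additive_mean e (Suc n) = e (Suc n) + real (Suc n) * (S + 2 * e n / (real n * (real n + 1)))"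
    using step.hyps by (simp add: additive_mean_def S_def sum_distrib_left sum_divide_distrib mult_ac distrib_left)
  also have "\<dots> = e (Suc n) + real (Suc n) * S + 2 * e n / real n"
  proof -
    have "real (Suc n) * (2 * e n / (real n * (real n + 1))) = 2 * e n / real n"
      using \<open>1 \<le> n\<close> by (simp add: divide_simps)
    then show ?thesis by (simp add: distrib_left)
  qed
  finally show ?case
    using step by (simp add: m field_simps)
qed

lemma sum_nat_diff_reflect:
  fixes m :: "nat \<Rightarrow> real"
  shows "(\<Sum>k=1..<n. m (n - k)) = (\<Sum>k=1..<n. m k)"
  by (rule sum.reindex_bij_witness[of _ "\<lambda>k. n - k" "\<lambda>k. n - k"]) auto

lemma additive_mean_rec:
  assumes "n \<ge> 2"
  shows "additive_mean e n = (\<Sum>k=1..<n. e n + additive_mean e k + additive_mean e (n - k)) / (real n - 1)"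
  using assms sum_additive_mean[of n e] sum_nat_diff_reflect[of "additive_mean e" n]
  by (simp add: sum.distrib of_nat_diff field_simps)

text \<open>By linearity only the mean of the toll at each size enters. The root split then gives
  the recurrence that \<open>additive_mean\<close> solves.\<close>

lemma bst_mean_fringe_sum:
  assumes "n \<ge> 1"
  shows "bst_mean n (fringe_sum f) = additive_mean (\<lambda>k. bst_mean k f) n"
  using assms
proof (induction n rule: less_induct)
  case (less n)
  show ?case
  proof (cases "n = 1")
    case True
    then show ?thesis by (simp add: bst_mean_1 del: One_nat_def)
  next
    case False
    with less.prems have n: "n \<ge> 2" by simp
    have "bst_mean n (fringe_sum f) = bst_mean n f + bst_mean n (\<lambda>t. fringe_sum f t - f t)"
      by (simp add: bst_mean_diff)
    also have "bst_mean n (\<lambda>t. fringe_sum f t - f t) =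
        (\<Sum>k=1..<n. bst_mean k (\<lambda>l. bst_mean (n - k) (\<lambda>r. fringe_sum f l + fringe_sum f r))) / (real n - 1)"
      by (subst bst_mean_rec[OF n]) simp
    also have "\<dots> = (\<Sum>k=1..<n. bst_mean k (fringe_sum f) + bst_mean (n - k) (fringe_sum f)) / (real n - 1)"
      by (simp add: bst_mean_add bst_mean_const Suc_le_eq)
    also have "\<dots> = (\<Sum>k=1..<n. additive_mean (\<lambda>k. bst_mean k f) k + additive_mean (\<lambda>k. bst_mean k f) (n - k)) / (real n - 1)"
      using less.IH by (intro arg_cong2[where f = "(/)"] sum.cong refl) auto
    also have "bst_mean n f + \<dots> = additive_mean (\<lambda>k. bst_mean k f) n"
      unfolding additive_mean_rec[OF n] using n
      by (simp add: sum.distrib of_nat_diff field_simps)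
    finally show ?thesis .
  qed
qed

text \<open>The cross term \<open>2 * a * g t\<close> has mean 0.\<close>

lemma bst_mean_centered_square:
  assumes "n \<ge> 1" "bst_mean n g = 0"
  shows "bst_mean n (\<lambda>t. (a + g t) ^ 2) = a ^ 2 + bst_mean n (\<lambda>t. g t ^ 2)"
  using assms by (simp add: power2_sum bst_mean_add bst_mean_const bst_mean_cmult mult.assoc)

text \<open>
  Given the root split, the two subtrees are independent, so the variances satisfy the same recurrence
  as the means, with the squared error of the means as toll; \<open>w\<close> is a supersolution of it.
\<close>

lemma variance_fringe_sum_le:
  fixes c b w :: "nat \<Rightarrow> real"
  defines "m \<equiv> additive_mean c"
  defines "F \<equiv> fringe_sum (\<lambda>s. c (size1 s))"
  assumes b: "\<And>n k. 1 \<le> k \<Longrightarrow> k < n \<Longrightarrow> (c n + m k + m (n - k) - m n) ^ 2 \<le> b n"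
    and w1: "w 1 \<ge> 0"
    and w: "\<And>n. n \<ge> 2 \<Longrightarrow> (real n - 1) * b n + 2 * (\<Sum>k=1..<n. w k) \<le> (real n - 1) * w n"
    and "n \<ge> 1"
  shows "bst_mean n (\<lambda>t. (F t - m n) ^ 2) \<le> w n"
  using \<open>n \<ge> 1\<close>
proof (induction n rule: less_induct)
  case (less n)
  show ?case
  proof (cases "n = 1")
    case True
    then show ?thesis using w1 by (simp add: bst_mean_1 F_def m_def del: One_nat_def)
  next
    case False
    with less.prems have n: "n \<ge> 2" by simp
    have centered: "bst_mean k (\<lambda>t. F t - m k) = 0" if "k \<ge> 1" for k
    proof -
      have "bst_mean j (\<lambda>s. c (size1 s)) = c j" if "j \<ge> 1" for j
      proof -
        have "bst_mean j (\<lambda>s. c (size1 s)) = bst_mean j (\<lambda>_. c j)"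
          by (rule bst_mean_cong) simp
        then show ?thesis using that by (simp add: bst_mean_const)
      qed
      then have "bst_mean k F = m k"
        using that unfolding F_def m_def
        by (subst bst_mean_fringe_sum) (auto simp: additive_mean_def)
      then show ?thesis using that by (simp add: bst_mean_diff bst_mean_const)
    qed
    let ?v = "\<lambda>k. bst_mean k (\<lambda>t. (F t - m k) ^ 2)"
    have "bst_mean n (\<lambda>t. (F t - m n) ^ 2) =
        (\<Sum>k=1..<n. bst_mean k (\<lambda>l. bst_mean (n - k) (\<lambda>r. (F (Node l () r) - m n) ^ 2))) / (real n - 1)"
      by (rule bst_mean_rec[OF n])
    also have "\<dots> = (\<Sum>k=1..<n. (c n + m k + m (n - k) - m n) ^ 2 + ?v k + ?v (n - k)) / (real n - 1)"
    proof (intro arg_cong2[where f = "(/)"] sum.cong refl)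
      fix k assume k: "k \<in> {1..<n}"
      \<comment> \<open>\<open>d\<close> is the error of the conditional mean when the left subtree
        has size \<open>k\<close>. The right and then the left subtree are averaged out, each time
        without a cross term.\<close>
      define d where "d = c n + m k + m (n - k) - m n"
      have "bst_mean k (\<lambda>l. bst_mean (n - k) (\<lambda>r. (F (Node l () r) - m n) ^ 2)) =
          bst_mean k (\<lambda>l. bst_mean (n - k) (\<lambda>r. ((d + (F l - m k)) + (F r - m (n - k))) ^ 2))"
        using k by (intro bst_mean_cong) (simp add: F_def d_def algebra_simps)
      also have "\<dots> = bst_mean k (\<lambda>l. (d + (F l - m k)) ^ 2 + ?v (n - k))"
        using k centered[of "n - k"] by (subst bst_mean_centered_square) auto
      also have "\<dots> = d ^ 2 + ?v k + ?v (n - k)"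
        using k centered[of k] by (simp add: bst_mean_add bst_mean_const bst_mean_centered_square)
      finally show "bst_mean k (\<lambda>l. bst_mean (n - k) (\<lambda>r. (F (Node l () r) - m n) ^ 2)) =
          (c n + m k + m (n - k) - m n) ^ 2 + ?v k + ?v (n - k)"
        by (simp add: d_def)
    qed
    also have "\<dots> \<le> (\<Sum>k=1..<n. b n + w k + w (n - k)) / (real n - 1)"
      using n less.IH b by (intro divide_right_mono sum_mono add_mono) auto
    also have "\<dots> = ((real n - 1) * b n + 2 * (\<Sum>k=1..<n. w k)) / (real n - 1)"
      using n sum_nat_diff_reflect[of w n] by (simp add: sum.distrib of_nat_diff)
    also have "\<dots> \<le> w n"
      using w[OF n] n by (simp add: field_simps)
    finally show ?thesis .
  qed
qed

section \<open>Large fringe subtrees and concentration of the probability of a random tree\<close>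

lemma bst_mean_size1: "n \<ge> 1 \<Longrightarrow> bst_mean n (\<lambda>t. c (size1 t)) = c n"
  using bst_mean_cong[of n "\<lambda>t. c (size1 t)" "\<lambda>_. c n"] bst_mean_const[of n "c n"] by simp

lemma additive_mean_cong:
  "(\<And>k. 1 \<le> k \<Longrightarrow> k \<le> n \<Longrightarrow> e k = e' k) \<Longrightarrow> n \<ge> 1 \<Longrightarrow> additive_mean e n = additive_mean e' n"
  unfolding additive_mean_def by (intro arg_cong2[where f = "(+)"] sum.cong) auto

lemma additive_mean_mono:
  "(\<And>k. 1 \<le> k \<Longrightarrow> k \<le> n \<Longrightarrow> e k \<le> e' k) \<Longrightarrow> n \<ge> 1 \<Longrightarrow> additive_mean e n \<le> additive_mean e' n"
  unfolding additive_mean_def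
  by (intro add_mono sum_mono divide_right_mono mult_left_mono) auto

lemma additive_mean_cmult: "additive_mean (\<lambda>k. a * e k) n = a * additive_mean e n"
  by (simp add: additive_mean_def distrib_left sum_distrib_left mult_ac)

lemma bst_mean_fringe_sum_size1:
  assumes "n \<ge> 1"
  shows "bst_mean n (fringe_sum (\<lambda>s. c (size1 s))) = additive_mean c n"
  using assms by (simp add: bst_mean_fringe_sum) (auto intro!: additive_mean_cong simp: bst_mean_size1)

definition num_large_fringe :: "nat \<Rightarrow> unit tree \<Rightarrow> real" where
  "num_large_fringe K = fringe_sum (\<lambda>s. of_bool (K \<le> size1 s))"

text \<open>The sum telescopes, as \<open>2 / (k * (k + 1)) = 2 / k - 2 / (k + 1)\<close>.\<close>

lemma sum_large_weights:
  assumes "K \<ge> 1" "n \<ge> 1"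
  shows "(\<Sum>k=1..<n. 2 * of_bool (K \<le> k) / (real k * (real k + 1))) =
    (if K \<le> n then 2 / real K - 2 / real n else 0)"
  using assms(2)
proof (induction n rule: dec_induct)
  case base
  show ?case using assms by auto
next
  case (step n)
  have "2 / (real n * (real n + 1)) = 2 / real n - 2 / (real n + 1)"
    using \<open>1 \<le> n\<close> by (simp add: divide_simps)
  then show ?case using step by (auto simp: le_Suc_eq add.commute)
qed

lemma additive_mean_large:
  assumes "K \<ge> 1" "n \<ge> 1"
  shows "additive_mean (\<lambda>k. of_bool (K \<le> k)) n = (if K \<le> n then 2 * real n / real K - 1 else 0)"
proof -
  have "additive_mean (\<lambda>k. of_bool (K \<le> k)) n =
      of_bool (K \<le> n) + real n * (\<Sum>k=1..<n. 2 * of_bool (K \<le> k) / (real k * (real k + 1)))"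
    by (simp add: additive_mean_def sum_distrib_left mult_ac)
  then show ?thesis
    unfolding sum_large_weights[OF assms] using assms by (simp add: right_diff_distrib)
qed

lemma bst_mean_num_large:
  assumes "K \<ge> 1" "n \<ge> K"
  shows "bst_mean n (num_large_fringe K) = 2 * real n / real K - 1"
  using assms unfolding num_large_fringe_def
  by (subst bst_mean_fringe_sum_size1[where c = "\<lambda>k. of_bool (K \<le> k)"]) (auto simp: additive_mean_large)

text \<open>Above the cutoff the mean \<open>2 * k / K - 1\<close> is affine, so the error at a root
  split is at most 2, and it is 0 for trees below the cutoff. Four times the mean therefore
  satisfies the variance recurrence with equality for the toll
  \<open>4 * of_bool (K \<le> n)\<close>.\<close>

lemma variance_num_large:
  assumes K: "K \<ge> 1" and n: "n \<ge> K"
  shows "bst_mean n (\<lambda>t. (num_large_fringe K t - (2 * real n / real K - 1)) ^ 2) \<le> 8 * real n / real K"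
proof -
  let ?c = "\<lambda>k. of_bool (K \<le> k) :: real"
  let ?m = "additive_mean ?c"
  have m: "?m k = (if K \<le> k then 2 * real k / real K - 1 else 0)" if "k \<ge> 1" for k
    using additive_mean_large[OF K that] .
  have "bst_mean n (\<lambda>t. (fringe_sum (\<lambda>s. ?c (size1 s)) t - ?m n) ^ 2) \<le> 4 * ?m n"
  proof (rule variance_fringe_sum_le[where b = "\<lambda>k. 4 * ?c k"])
    fix n k :: nat assume k: "1 \<le> k" "k < n"
    have "\<bar>?c n + ?m k + ?m (n - k) - ?m n\<bar> \<le> 2 * ?c n"
    proof (cases "K \<le> n")
      case False
      then show ?thesis using k by (simp add: m)
    next
      case True
      define a b where "a = 2 * real k / real K" and "b = 2 * real (n - k) / real K"
      have ab: "2 * real n / real K = a + b"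
        using k by (simp add: a_def b_def of_nat_diff right_diff_distrib diff_divide_distrib)
      \<comment> \<open>The error is \<open>0\<close>, \<open>1 - b\<close>, \<open>1 - a\<close> or
        \<open>2 - a - b\<close>, according to which of the two subtrees reach the cutoff.\<close>
      have "K \<le> k \<or> a \<le> 2" "K \<le> n - k \<or> b \<le> 2" "a \<ge> 0" "b \<ge> 0" "a + b \<ge> 2"
        using K True unfolding ab [symmetric] a_def b_def by (auto simp: field_simps)
      moreover have "?m k = (if K \<le> k then a - 1 else 0)"
        "?m (n - k) = (if K \<le> n - k then b - 1 else 0)" "?m n = a + b - 1"
        using k True m[of k] m[of "n - k"] m[of n] ab by (simp_all add: a_def b_def)
      ultimately show ?thesis
        using True by (auto simp: abs_le_iff split: if_splits)
    qed
    then have "\<bar>?c n + ?m k + ?m (n - k) - ?m n\<bar> ^ 2 \<le> (2 * ?c n) ^ 2"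
      by (intro power_mono) auto
    then show "(?c n + ?m k + ?m (n - k) - ?m n) ^ 2 \<le> 4 * ?c n"
      by (auto simp: power_mult_distrib of_bool_def split: if_splits)
  next
    fix n :: nat assume "n \<ge> 2"
    then show "(real n - 1) * (4 * ?c n) + 2 * (\<Sum>k=1..<n. 4 * ?m k) \<le> (real n - 1) * (4 * ?m n)"
      using sum_additive_mean[of n ?c]
      by (simp add: sum_distrib_left [symmetric] right_diff_distrib)
  qed (use K n in auto)
  then show ?thesis
    using assms m[of n] by (simp add: num_large_fringe_def)
qed

lemma prob_num_large_deviation:
  assumes K: "K \<ge> 1" and n: "n \<ge> K" and \<epsilon>: "\<epsilon> > 0"
  shows "bst_mean n (\<lambda>t. of_bool (\<bar>num_large_fringe K t - (2 * real n / real K - 1)\<bar> \<ge> \<epsilon> * (real n / real K)))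
    \<le> 8 / \<epsilon> ^ 2 * (real K / real n)"
proof -
  let ?a = "\<epsilon> * (real n / real K)"
  have a: "?a > 0" using assms by simp
  have "bst_mean n (\<lambda>t. of_bool (\<bar>num_large_fringe K t - (2 * real n / real K - 1)\<bar> \<ge> ?a))
      \<le> bst_mean n (\<lambda>t. (num_large_fringe K t - (2 * real n / real K - 1)) ^ 2) / ?a ^ 2"
    by (rule bst_mean_Chebyshev[OF a])
  also have "\<dots> \<le> (8 * real n / real K) / ?a ^ 2"
    by (intro divide_right_mono variance_num_large K n) auto
  also have "\<dots> = 8 / \<epsilon> ^ 2 * (real K / real n)"
    using assms by (simp add: field_simps power2_eq_square)
  finally show ?thesis .
qed

section \<open>The logarithm of the probability of a random tree\<close>

definition log_toll :: "nat \<Rightarrow> nat \<Rightarrow> real" where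
  "log_toll M k = (if k \<le> M then ln (real (k - 1)) else 0)"

text \<open>\<open>log_toll M\<close> is the toll of \<open>- ln (P_bst t)\<close> cut off at size
  \<open>M\<close>. For \<open>n > M\<close> the root pays nothing and the sum in the closed form
  stops at \<open>M\<close>, hence exact linearity.\<close>

lemma additive_mean_log_toll:
  assumes "n > M"
  shows "additive_mean (log_toll M) n = truncated_entropy M * real n"
proof -
  have "(\<Sum>k=1..<n. 2 * real n * log_toll M k / (real k * (real k + 1))) =
      (\<Sum>k=1..M. 2 * real n * ln (real (k - 1)) / (real k * (real k + 1)))"
    using assms by (intro sum.mono_neutral_cong_right) (auto simp: log_toll_def)
  also have "\<dots> = real n * truncated_entropy M"
    by (simp add: truncated_entropy_def sum_distrib_left mult_ac)
  finally show ?thesis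
    using assms by (simp add: additive_mean_def log_toll_def)
qed

text \<open>Exact linearity of the mean beyond \<open>M\<close> keeps the error at a root split
  bounded uniformly in the size, and a bounded squared error gives linear variance.\<close>

lemma variance_log_toll:
  obtains C where "\<And>n. n \<ge> 1 \<Longrightarrow>
    bst_mean n (\<lambda>t. (fringe_sum (\<lambda>s. log_toll M (size1 s)) t - additive_mean (log_toll M) n) ^ 2) \<le> C * real n"
proof -
  let ?m = "additive_mean (log_toll M)" and ?h = "truncated_entropy M"
  \<comment> \<open>\<open>D\<close> bounds the toll and the deviation of the mean from linearity.
    Beyond \<open>M\<close> both vanish, so a finite sum is enough.\<close>
  define D where "D = (\<Sum>k\<le>M. \<bar>?m k - ?h * real k\<bar> + \<bar>log_toll M k\<bar>)"
  have D0: "D \<ge> 0" unfolding D_def by (intro sum_nonneg) auto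
  have D: "\<bar>?m k - ?h * real k\<bar> \<le> D \<and> \<bar>log_toll M k\<bar> \<le> D" for k
  proof (cases "k \<le> M")
    case True
    then have "\<bar>?m k - ?h * real k\<bar> + \<bar>log_toll M k\<bar> \<le> D"
      unfolding D_def by (intro member_le_sum) auto
    then show ?thesis by auto
  next
    case False
    then show ?thesis using D0 by (simp add: additive_mean_log_toll log_toll_def)
  qed
  define C where "C = (4 * D) ^ 2"
  have C: "C \<ge> 0" by (simp add: C_def)
  show thesis
  proof (rule that)
    fix n :: nat assume n: "n \<ge> 1"
    \<comment> \<open>\<open>C * (2 * n - 1)\<close> solves the variance recurrence with constant
      toll \<open>C\<close>, because the odd numbers below \<open>2 * n - 2\<close> add up to
      \<open>(n - 1) ^ 2\<close>.\<close>
    have "bst_mean n (\<lambda>t. (fringe_sum (\<lambda>s. log_toll M (size1 s)) t - ?m n) ^ 2) \<le> C * (2 * real n - 1)"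
    proof (rule variance_fringe_sum_le[where b = "\<lambda>_. C"])
      fix n k :: nat assume k: "1 \<le> k" "k < n"
      have "?h * real k + ?h * real (n - k) = ?h * real n"
        using k by (simp add: of_nat_diff algebra_simps)
      then have "\<bar>log_toll M n + ?m k + ?m (n - k) - ?m n\<bar> \<le> 4 * D"
        using D[of n] D[of k] D[of "n - k"] by linarith
      then have "\<bar>log_toll M n + ?m k + ?m (n - k) - ?m n\<bar> ^ 2 \<le> C"
        unfolding C_def by (intro power_mono) auto
      then show "(log_toll M n + ?m k + ?m (n - k) - ?m n) ^ 2 \<le> C" by simp
    next
      fix n :: nat assume "n \<ge> 2"
      have *: "(\<Sum>k=1..<n. 2 * real k - 1) = (real n - 1) ^ 2" if "n \<ge> 1" for n :: nat
        using that by (induction n rule: dec_induct) (auto simp: power2_eq_square algebra_simps)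
      show "(real n - 1) * C + 2 * (\<Sum>k=1..<n. C * (2 * real k - 1)) \<le> (real n - 1) * (C * (2 * real n - 1))"
        using \<open>n \<ge> 2\<close> unfolding sum_distrib_left [symmetric]
        by (subst *) (auto simp: power2_eq_square algebra_simps)
    qed (use n C in auto)
    also have "\<dots> \<le> 2 * C * real n" using C by (simp add: algebra_simps)
    finally show "bst_mean n (\<lambda>t. (fringe_sum (\<lambda>s. log_toll M (size1 s)) t - ?m n) ^ 2) \<le> 2 * C * real n" .
  qed
qed

lemma P_bst_pos: "P_bst t > 0"
proof (induction t)
  case (Node l a r)
  have "real (size1 l + size1 r) - 1 > 0"
    using size1_ge0[of l] size1_ge0[of r] by linarith
  then show ?case using Node by simp
qed simp

text \<open>The logarithm turns the product into an additive functional; leaves contribute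
  \<open>ln 0 = 0\<close>.\<close>

lemma ln_P_bst: "- ln (P_bst t) = fringe_sum (\<lambda>s. ln (real (size1 s - 1))) t"
proof (induction t)
  case (Node l a r)
  have "real (size1 l + size1 r - 1) = real (size1 l + size1 r) - 1"
    using size1_ge0[of l] by (subst of_nat_diff) linarith+
  moreover have "real (size1 l + size1 r) - 1 > 0"
    using size1_ge0[of l] size1_ge0[of r] by linarith
  ultimately show ?case
    using Node P_bst_pos[of l] P_bst_pos[of r] by (simp add: ln_div ln_mult)
qed simp

text \<open>If \<open>P_bst t\<close> is this large, the truncated functional lies at least
  \<open>(truncated_entropy M - h) * n\<close> below its mean. Its variance is linear in
  \<open>n\<close>, so Chebyshev's inequality bounds the probability by a multiple of
  \<open>1 / n\<close>.\<close>

lemma prob_P_bst_large: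
  assumes h: "h < truncated_entropy M"
  shows "(\<lambda>n. bst_mean n (\<lambda>t. of_bool (P_bst t > exp (- h * real n)))) \<longlonglongrightarrow> 0"
proof -
  obtain C where C: "\<And>n. n \<ge> 1 \<Longrightarrow>
    bst_mean n (\<lambda>t. (fringe_sum (\<lambda>s. log_toll M (size1 s)) t - additive_mean (log_toll M) n) ^ 2) \<le> C * real n"
    using variance_log_toll[of M] by blast
  define d where "d = truncated_entropy M - h"
  have d: "d > 0" using h by (simp add: d_def)
  show ?thesis
  proof (rule tendsto_sandwich[OF _ _ tendsto_const])
    show "\<forall>\<^sub>F n in sequentially. 0 \<le> bst_mean n (\<lambda>t. of_bool (P_bst t > exp (- h * real n)))"
      by (intro always_eventually allI bst_mean_nonneg) auto
    show "(\<lambda>n. C / d ^ 2 / real n) \<longlonglongrightarrow> 0"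
      by real_asymp
    show "\<forall>\<^sub>F n in sequentially. bst_mean n (\<lambda>t. of_bool (P_bst t > exp (- h * real n))) \<le> C / d ^ 2 / real n"
      using eventually_gt_at_top[of "max 1 M"]
    proof eventually_elim
      case (elim n)
      let ?F = "fringe_sum (\<lambda>s. log_toll M (size1 s))"
      let ?m = "additive_mean (log_toll M) n"
      have "bst_mean n (\<lambda>t. of_bool (P_bst t > exp (- h * real n))) \<le>
          bst_mean n (\<lambda>t. of_bool (\<bar>?F t - ?m\<bar> \<ge> d * real n))"
      proof (rule bst_mean_mono)
        fix t :: "unit tree" assume "size1 t = n"
        have "d * real n \<le> \<bar>?F t - ?m\<bar>" if "P_bst t > exp (- h * real n)"
        proof -
          have "ln (exp (- h * real n)) < ln (P_bst t)"
            using that P_bst_pos[of t] by (subst ln_less_cancel_iff) auto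
          then have "- ln (P_bst t) < h * real n" by simp
          \<comment> \<open>Truncation drops only nonnegative tolls.\<close>
          moreover have "?F t \<le> - ln (P_bst t)"
            unfolding ln_P_bst
          proof (rule fringe_sum_mono)
            fix s :: "unit tree"
            show "log_toll M (size1 s) \<le> ln (real (size1 s - 1))"
              by (cases "size1 s - 1 = 0") (auto simp: log_toll_def)
          qed
          moreover have "?m = truncated_entropy M * real n"
            using elim by (intro additive_mean_log_toll) auto
          ultimately show ?thesis
            by (simp add: d_def left_diff_distrib)
        qed
        then show "of_bool (P_bst t > exp (- h * real n)) \<le> (of_bool (\<bar>?F t - ?m\<bar> \<ge> d * real n) :: real)"
          by auto
      qed
      also have "\<dots> \<le> bst_mean n (\<lambda>t. (?F t - ?m) ^ 2) / (d * real n) ^ 2"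
        using d elim by (intro bst_mean_Chebyshev) auto
      also have "\<dots> \<le> C * real n / (d * real n) ^ 2"
        using C[of n] elim by (intro divide_right_mono) auto
      also have "\<dots> = C / d ^ 2 / real n"
        by (simp add: power2_eq_square)
      finally show ?case .
    qed
  qed
qed

section \<open>Counting distinct fringe subtrees\<close>

definition occurrences :: "unit tree \<Rightarrow> unit tree \<Rightarrow> real" where
  "occurrences s = fringe_sum (\<lambda>u. of_bool (u = s))"

lemma occurrences_eq_count: "occurrences s t = real (count (fringe_subtrees t) s)"
  unfolding occurrences_def by (induction t) auto

lemma occurrences_nonneg: "occurrences s t \<ge> 0"
  by (simp add: occurrences_eq_count)

lemma occurrences_Node:
  "occurrences s (Node l a r) = of_bool (Node l a r = s) + occurrences s l + occurrences s r"
  by (simp add: occurrences_def)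

lemma size1_subtrees: "s \<in> subtrees t \<Longrightarrow> size1 s \<le> size1 t"
  by (simp add: size1_size size_subtrees)

lemma occurrences_eq_0:
  assumes "size1 t < size1 s"
  shows "occurrences s t = 0"
proof -
  have "s \<notin> subtrees t" using assms size1_subtrees[of s t] by auto
  then show ?thesis
    by (simp add: occurrences_eq_count count_eq_zero_iff set_mset_fringe_subtrees)
qed

text \<open>The toll has mean \<open>P_bst s\<close> at size \<open>K\<close> and 0 elsewhere. For
  \<open>n > K\<close> the exact factor is \<open>2 * n / (K * (K + 1))\<close>, which is at most
  \<open>n\<close>.\<close>

lemma bst_mean_occurrences_le:
  assumes n: "n \<ge> 1"
  shows "bst_mean n (occurrences s) \<le> real n * P_bst s"
proof -
  define K where "K = size1 s"
  have K: "K \<ge> 1" unfolding K_def using size1_ge0[of s] by linarith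
  have e: "bst_mean k (\<lambda>u. of_bool (u = s)) = P_bst s * of_bool (k = K)" for k
  proof -
    have "bst_mean k (\<lambda>u. of_bool (u = s)) = (\<Sum>t | size1 t = k. if t = s then P_bst s else 0)"
      unfolding bst_mean_def by (intro sum.cong) auto
    also have "\<dots> = P_bst s * of_bool (k = K)"
      by (subst sum.delta) (auto simp: finite_trees_of_size1 K_def)
    finally show ?thesis .
  qed
  have "additive_mean (\<lambda>k. of_bool (k = K)) n \<le> real n"
  proof -
    have "(\<Sum>k=1..<n. 2 * real n * of_bool (k = K) / (real k * (real k + 1))) =
        (\<Sum>k=1..<n. if k = K then 2 * real n / (real K * (real K + 1)) else 0)"
      by (intro sum.cong) auto
    also have "\<dots> = (if K < n then 2 * real n / (real K * (real K + 1)) else 0)"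
      using K by (subst sum.delta) auto
    also have "\<dots> \<le> real n * of_bool (K < n)"
    proof -
      have "2 \<le> real K * (real K + 1)"
        using K mult_mono[of 1 "real K" 2 "real K + 1"] by simp
      then have "2 / (real K * (real K + 1)) \<le> 1" using K by simp
      then have "real n * (2 / (real K * (real K + 1))) \<le> real n * 1"
        by (rule mult_left_mono) simp
      then show ?thesis by (simp add: mult.commute)
    qed
    finally show ?thesis
      using n by (cases n K rule: linorder_cases) (auto simp: additive_mean_def)
  qed
  then have "P_bst s * additive_mean (\<lambda>k. of_bool (k = K)) n \<le> P_bst s * real n"
    by (rule mult_left_mono) (rule P_bst_nonneg)
  then show ?thesis
    by (simp add: occurrences_def bst_mean_fringe_sum[OF n] e additive_mean_cmult mult.commute)
qed

text \<open>Two different occurrences lie both on the left, both on the right, or on different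
  sides; in the last case independence factors the mean. With \<open>p = P_bst s\<close> the three
  bounds add up to \<open>(k * p + (n - k) * p) ^ 2\<close>.\<close>

lemma bst_mean_occurrence_pairs_le:
  assumes "n \<ge> 1"
  shows "bst_mean n (\<lambda>t. occurrences s t * (occurrences s t - 1)) \<le> (real n * P_bst s) ^ 2"
  using assms
proof (induction n rule: less_induct)
  case (less n)
  let ?X = "occurrences s" and ?p = "P_bst s"
  let ?Q = "\<lambda>t. ?X t * (?X t - 1)"
  show ?case
  proof (cases "n = 1")
    case True
    then show ?thesis by (simp add: bst_mean_1 occurrences_def del: One_nat_def)
  next
    case False
    with less.prems have n: "n \<ge> 2" by simp
    have Q: "?Q (Node l () r) = ?Q l + ?Q r + 2 * (?X l * ?X r)" for l r
    proof (cases "Node l () r = s")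
      \<comment> \<open>An occurrence at the root excludes smaller trees from containing
        \<open>s\<close>, so both sides are 0.\<close>
      case True
      then have "size1 l < size1 s" "size1 r < size1 s"
        using size1_ge0[of l] size1_ge0[of r] by (auto simp del: size1_ge0)
      then show ?thesis by (simp add: occurrences_Node occurrences_eq_0)
    next
      case False
      then show ?thesis by (simp add: occurrences_Node algebra_simps)
    qed
    have "bst_mean n ?Q = (\<Sum>k=1..<n. bst_mean k (\<lambda>l. bst_mean (n - k) (\<lambda>r. ?Q (Node l () r)))) / (real n - 1)"
      by (rule bst_mean_rec[OF n])
    also have "\<dots> = (\<Sum>k=1..<n. bst_mean k ?Q + bst_mean (n - k) ?Q + 2 * (bst_mean k ?X * bst_mean (n - k) ?X)) / (real n - 1)"
    proof (intro arg_cong2[where f = "(/)"] sum.cong refl)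
      fix k assume k: "k \<in> {1..<n}"
      have "bst_mean k (\<lambda>l. bst_mean (n - k) (\<lambda>r. ?Q (Node l () r))) =
          bst_mean k (\<lambda>l. ?Q l + bst_mean (n - k) ?Q + 2 * bst_mean (n - k) ?X * ?X l)"
        unfolding Q using k
        by (intro bst_mean_cong) (simp only: bst_mean_add bst_mean_cmult bst_mean_const, simp add: bst_mean_const Suc_le_eq)
      also have "\<dots> = bst_mean k ?Q + bst_mean (n - k) ?Q + 2 * (bst_mean k ?X * bst_mean (n - k) ?X)"
        using k by (simp add: bst_mean_add bst_mean_cmult bst_mean_const)
      finally show "bst_mean k (\<lambda>l. bst_mean (n - k) (\<lambda>r. ?Q (Node l () r))) =
          bst_mean k ?Q + bst_mean (n - k) ?Q + 2 * (bst_mean k ?X * bst_mean (n - k) ?X)" .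
    qed
    also have "\<dots> \<le> (\<Sum>k=1..<n. (real n * ?p) ^ 2) / (real n - 1)"
    proof (intro divide_right_mono sum_mono)
      fix k assume k: "k \<in> {1..<n}"
      have "bst_mean k ?X * bst_mean (n - k) ?X \<le> (real k * ?p) * (real (n - k) * ?p)"
        using k by (intro mult_mono bst_mean_occurrences_le bst_mean_nonneg occurrences_nonneg)
          (auto simp: P_bst_nonneg)
      then have "bst_mean k ?Q + bst_mean (n - k) ?Q + 2 * (bst_mean k ?X * bst_mean (n - k) ?X) \<le>
          (real k * ?p) ^ 2 + (real (n - k) * ?p) ^ 2 + 2 * ((real k * ?p) * (real (n - k) * ?p))"
        using k by (intro add_mono less.IH mult_left_mono) auto
      also have "\<dots> = (real k * ?p + real (n - k) * ?p) ^ 2"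
        by (simp add: power2_sum)
      also have "real k * ?p + real (n - k) * ?p = real n * ?p"
        using k by (simp add: of_nat_diff left_diff_distrib)
      finally show "bst_mean k ?Q + bst_mean (n - k) ?Q + 2 * (bst_mean k ?X * bst_mean (n - k) ?X) \<le> (real n * ?p) ^ 2" .
    qed (use n in auto)
    also have "\<dots> = (real n * ?p) ^ 2"
      using n by (simp add: of_nat_diff)
    finally show ?thesis .
  qed
qed

lemma fringe_sum_cong:
  "(\<And>s. s \<in> subtrees t \<Longrightarrow> f s = g s) \<Longrightarrow> fringe_sum f t = fringe_sum g t"
  by (induction t) auto

text \<open>A natural number \<open>x\<close> satisfies
  \<open>x - x * (x - 1) \<le> of_bool (x > 0)\<close>: ordered pairs of coinciding occurrences
  overcompensate the multiple counting.\<close>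

lemma num_distinct_fringe_ge:
  assumes "finite A"
  shows "real (num_distinct_fringe t) \<ge>
    (\<Sum>s\<in>A. occurrences s t) - (\<Sum>s\<in>A. occurrences s t * (occurrences s t - 1))"
proof -
  have fin: "finite (subtrees t)"
    by (simp flip: set_mset_fringe_subtrees)
  have bound: "real x - real x * (real x - 1) \<le> of_bool (x > 0)" for x :: nat
  proof (cases "x \<le> 1")
    case True
    then show ?thesis by (auto simp: le_Suc_eq)
  next
    case False
    then have "real x * (real x - 2) \<ge> 0" by (intro mult_nonneg_nonneg) auto
    moreover have "real x - real x * (real x - 1) = - (real x * (real x - 2))"
      by (simp add: algebra_simps)
    ultimately show ?thesis by simp
  qed
  have "(\<Sum>s\<in>A. occurrences s t) - (\<Sum>s\<in>A. occurrences s t * (occurrences s t - 1)) \<le>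
      (\<Sum>s\<in>A. of_bool (s \<in> subtrees t))"
    unfolding sum_subtractf [symmetric] occurrences_eq_count set_mset_fringe_subtrees [symmetric]
  proof (rule sum_mono)
    fix s
    show "real (count (fringe_subtrees t) s) - real (count (fringe_subtrees t) s) * (real (count (fringe_subtrees t) s) - 1)
        \<le> of_bool (s \<in># fringe_subtrees t)"
      using bound[of "count (fringe_subtrees t) s"] by simp
  qed
  also have "\<dots> = real (card (A \<inter> subtrees t))"
    using assms by (simp add: of_bool_def sum.If_cases Int_def)
  also have "\<dots> \<le> real (num_distinct_fringe t)"
    unfolding num_distinct_fringe_def set_mset_fringe_subtrees
    by (intro of_nat_mono card_mono fin) auto
  finally show ?thesis .
qed

text \<open>The sum counts with multiplicity what the set counts once.\<close>

lemma card_subtrees_le_fringe_sum: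
  "real (card {s \<in> subtrees t. G s}) \<le> fringe_sum (\<lambda>s. of_bool (G s)) t"
proof (induction t)
  case Leaf
  have "{s \<in> subtrees (Leaf :: unit tree). G s} = (if G Leaf then {Leaf} else {})" by auto
  then show ?case by simp
next
  case (Node l a r)
  let ?S = "\<lambda>t. {s \<in> subtrees t. G s}"
  have "?S (Node l a r) = (if G (Node l a r) then {Node l a r} else {}) \<union> (?S l \<union> ?S r)"
    by auto
  then have "card (?S (Node l a r)) \<le>
      card (if G (Node l a r) then {Node l a r} else {}) + (card (?S l) + card (?S r))"
    by (metis (no_types, lifting) card_Un_le add_left_mono order_trans)
  then have "real (card (?S (Node l a r))) \<le> of_bool (G (Node l a r)) + (real (card (?S l)) + real (card (?S r)))"
    by (simp split: if_splits)
  then show ?case using Node by simp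
qed

section \<open>Counting small trees by a prefix code\<close>

primrec preorder_code :: "unit tree \<Rightarrow> bool list" where
  "preorder_code Leaf = [False]"
| "preorder_code (Node l a r) = True # preorder_code l @ preorder_code r"

text \<open>The arbitrary suffixes let the induction pass through the concatenation of the codes of
  the two subtrees.\<close>

lemma preorder_code_prefix_free:
  "preorder_code t @ xs = preorder_code t' @ ys \<Longrightarrow> t = t' \<and> xs = ys"
proof (induction t arbitrary: t' xs ys)
  case Leaf
  then show ?case by (cases t') auto
next
  case (Node l a r)
  show ?case
  proof (cases t')
    case Leaf
    then show ?thesis using Node.prems by simp
  next
    case t': (Node l' a' r')
    then have eq: "preorder_code l @ preorder_code r @ xs = preorder_code l' @ preorder_code r' @ ys"
      using Node.prems by simp
    then have "l = l'" and "preorder_code r @ xs = preorder_code r' @ ys"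
      using Node.IH(1) by blast+
    then show ?thesis
      using Node.IH(2)[of xs r' ys] t' by simp
  qed
qed

lemma length_preorder_code: "length (preorder_code t) + 1 = 2 * size1 t"
  by (induction t) auto

text \<open>Codes padded to length \<open>2 * K\<close> remain distinct by prefix-freeness. The base
  4 is the exponential growth rate of the Catalan numbers.\<close>

lemma card_small_trees: "card {t :: unit tree. size1 t < K} \<le> 4 ^ K"
proof (cases "K = 0")
  case True
  then show ?thesis by simp
next
  case False
  let ?pad = "\<lambda>t. preorder_code t @ replicate (2 * K - length (preorder_code t)) False"
  have "inj_on ?pad {t. size1 t < K}"
    by (intro inj_onI) (blast dest: preorder_code_prefix_free)
  moreover have "?pad ` {t. size1 t < K} \<subseteq> {xs. set xs \<subseteq> UNIV \<and> length xs = 2 * K}"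
  proof -
    have "length (preorder_code t) \<le> 2 * K" if "size1 t < K" for t
      using length_preorder_code[of t] that by linarith
    then show ?thesis by auto
  qed
  ultimately have "card {t :: unit tree. size1 t < K} \<le> card {xs :: bool list. set xs \<subseteq> UNIV \<and> length xs = 2 * K}"
    by (intro card_inj_on_le finite_lists_length_eq) auto
  also have "\<dots> = 4 ^ K"
    by (subst card_lists_length_eq) (auto simp: power_mult)
  finally show ?thesis .
qed

text \<open>Below the cutoff all trees are counted, occurring or not; from the cutoff on, all
  occurrences.\<close>

lemma num_distinct_fringe_le: "real (num_distinct_fringe t) \<le> 4 ^ K + num_large_fringe K t"
proof -
  have fin: "finite {s :: unit tree. size1 s < K}"
  proof -
    have "{s :: unit tree. size1 s < K} = (\<Union>k<K. {s. size1 s = k})" by auto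
    then show ?thesis by (simp add: finite_trees_of_size1)
  qed
  have "subtrees t \<subseteq> {s. size1 s < K} \<union> {s \<in> subtrees t. K \<le> size1 s}" by auto
  moreover have "finite (subtrees t)"
    by (simp flip: set_mset_fringe_subtrees)
  ultimately have "card (subtrees t) \<le> card {s :: unit tree. size1 s < K} + card {s \<in> subtrees t. K \<le> size1 s}"
    using fin by (intro order_trans[OF card_mono card_Un_le]) auto
  also have "\<dots> \<le> 4 ^ K + card {s \<in> subtrees t. K \<le> size1 s}"
    using card_small_trees by simp
  finally have "real (card (subtrees t)) \<le> real (4 ^ K + card {s \<in> subtrees t. K \<le> size1 s})"
    by (rule of_nat_mono)
  also have "\<dots> \<le> 4 ^ K + num_large_fringe K t"
    using card_subtrees_le_fringe_sum[of t "\<lambda>s. K \<le> size1 s"] by (simp add: num_large_fringe_def)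
  finally show ?thesis
    by (simp add: num_distinct_fringe_def set_mset_fringe_subtrees)
qed

text \<open>The bound \<open>n\<close> makes the set finite, and no fringe subtree of a tree with
  \<open>n\<close> leaves exceeds it.\<close>

definition good_trees :: "real \<Rightarrow> nat \<Rightarrow> nat \<Rightarrow> unit tree set" where
  "good_trees h K n = {s. K \<le> size1 s \<and> size1 s \<le> n \<and> P_bst s \<le> exp (- h * real (size1 s))}"

definition num_bad_fringe :: "real \<Rightarrow> nat \<Rightarrow> unit tree \<Rightarrow> real" where
  "num_bad_fringe h K = fringe_sum (\<lambda>s. of_bool (K \<le> size1 s \<and> P_bst s > exp (- h * real (size1 s))))"

lemma good_trees_subset: "good_trees h K n \<subseteq> (\<Union>k\<in>{K..n}. {s. size1 s = k})"
  by (auto simp: good_trees_def)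

lemma finite_good_trees: "finite (good_trees h K n)"
  using finite_subset[OF good_trees_subset] finite_trees_of_size1 by blast

text \<open>One factor \<open>P_bst s\<close> is at most \<open>exp (- h * size1 s)\<close>, the
  other sums to at most 1 over each size. A geometric series remains.\<close>

lemma sum_P_bst_square_good_trees:
  assumes K: "K \<ge> 1" and h: "h > 0"
  shows "(\<Sum>s\<in>good_trees h K n. P_bst s ^ 2) \<le> exp (- h * real K) / (1 - exp (- h))"
proof -
  have "(\<Sum>s\<in>good_trees h K n. P_bst s ^ 2) \<le> (\<Sum>s\<in>good_trees h K n. exp (- h * real (size1 s)) * P_bst s)"
    unfolding power2_eq_square
    by (intro sum_mono mult_right_mono P_bst_nonneg) (auto simp: good_trees_def)
  also have "\<dots> \<le> (\<Sum>s\<in>(\<Union>k\<in>{K..n}. {s. size1 s = k}). exp (- h * real (size1 s)) * P_bst s)"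
    by (intro sum_mono2 good_trees_subset) (auto intro: finite_trees_of_size1 mult_nonneg_nonneg P_bst_nonneg)
  also have "\<dots> = (\<Sum>k=K..n. \<Sum>s | size1 s = k. exp (- h * real (size1 s)) * P_bst s)"
    by (intro sum.UNION_disjoint) (auto intro: finite_trees_of_size1)
  also have "\<dots> = (\<Sum>k=K..n. exp (- h) ^ k)"
  proof (intro sum.cong refl)
    fix k assume k: "k \<in> {K..n}"
    have "(\<Sum>s | size1 s = k. exp (- h * real (size1 s)) * P_bst s) = exp (- h * real k) * (\<Sum>s | size1 s = k. P_bst s)"
      by (simp add: sum_distrib_left)
    also have "\<dots> = exp (- h) ^ k"
      using k K by (simp add: sum_P_bst exp_of_nat_mult [symmetric] mult.commute)
    finally show "(\<Sum>s | size1 s = k. exp (- h * real (size1 s)) * P_bst s) = exp (- h) ^ k" .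
  qed
  also have "\<dots> \<le> exp (- h) ^ K / (1 - exp (- h))"
    using h by (auto simp: sum_gp intro!: divide_right_mono)
  also have "exp (- h) ^ K = exp (- h * real K)"
    by (simp add: exp_of_nat_mult [symmetric] mult.commute)
  finally show ?thesis .
qed

text \<open>The large fringe subtrees that are not bad are exactly the occurrences of good trees, so
  \<open>num_distinct_fringe_ge\<close> applies to \<open>good_trees h K n\<close>.\<close>

lemma num_distinct_fringe_ge_large:
  assumes "size1 t = n"
  shows "real (num_distinct_fringe t) \<ge> num_large_fringe K t - num_bad_fringe h K t
    - (\<Sum>s\<in>good_trees h K n. occurrences s t * (occurrences s t - 1))"
proof -
  have "num_large_fringe K t - num_bad_fringe h K t =
      fringe_sum (\<lambda>u. \<Sum>s\<in>good_trees h K n. of_bool (u = s)) t"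
    unfolding num_large_fringe_def num_bad_fringe_def fringe_sum_diff [symmetric]
  proof (rule fringe_sum_cong)
    fix s assume "s \<in> subtrees t"
    then have s: "size1 s \<le> n" using size1_subtrees[of s t] assms by simp
    have "(\<Sum>u\<in>good_trees h K n. of_bool (s = u)) = (of_bool (s \<in> good_trees h K n) :: real)"
      using finite_good_trees by (simp add: of_bool_def)
    then show "of_bool (K \<le> size1 s) - of_bool (K \<le> size1 s \<and> P_bst s > exp (- h * real (size1 s))) =
        (\<Sum>u\<in>good_trees h K n. of_bool (s = u) :: real)"
      using s by (auto simp: good_trees_def)
  qed
  also have "\<dots> = (\<Sum>s\<in>good_trees h K n. occurrences s t)"
    by (simp add: fringe_sum_sum occurrences_def)
  finally show ?thesis
    using num_distinct_fringe_ge[OF finite_good_trees, of t h K n] by simp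
qed

lemma bst_mean_good_pairs_le:
  assumes "n \<ge> 1" "K \<ge> 1" "h > 0"
  shows "bst_mean n (\<lambda>t. \<Sum>s\<in>good_trees h K n. occurrences s t * (occurrences s t - 1))
    \<le> real n ^ 2 * (exp (- h * real K) / (1 - exp (- h)))"
proof -
  have "bst_mean n (\<lambda>t. \<Sum>s\<in>good_trees h K n. occurrences s t * (occurrences s t - 1))
      \<le> (\<Sum>s\<in>good_trees h K n. (real n * P_bst s) ^ 2)"
    unfolding bst_mean_sum using assms by (intro sum_mono bst_mean_occurrence_pairs_le)
  also have "\<dots> = real n ^ 2 * (\<Sum>s\<in>good_trees h K n. P_bst s ^ 2)"
    by (simp add: power_mult_distrib sum_distrib_left)
  also have "\<dots> \<le> real n ^ 2 * (exp (- h * real K) / (1 - exp (- h)))"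
    using assms by (intro mult_left_mono sum_P_bst_square_good_trees) auto
  finally show ?thesis .
qed

text \<open>At each size from \<open>K\<close> on, the toll has mean at most \<open>p\<close>, so
  the mean is at most \<open>p\<close> times that of \<open>num_large_fringe K\<close>.\<close>

lemma bst_mean_num_bad_le:
  assumes "K \<ge> 1" "n \<ge> K" "p \<ge> 0"
    and p: "\<And>k. k \<ge> K \<Longrightarrow> bst_mean k (\<lambda>s. of_bool (P_bst s > exp (- h * real k))) \<le> p"
  shows "bst_mean n (num_bad_fringe h K) \<le> p * (2 * (real n / real K))"
proof -
  have n: "n \<ge> 1" using assms by simp
  have "bst_mean n (num_bad_fringe h K) =
      additive_mean (\<lambda>k. bst_mean k (\<lambda>s. of_bool (K \<le> size1 s \<and> P_bst s > exp (- h * real (size1 s))))) n"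
    unfolding num_bad_fringe_def by (rule bst_mean_fringe_sum[OF n])
  also have "\<dots> \<le> additive_mean (\<lambda>k. p * of_bool (K \<le> k)) n"
  proof (rule additive_mean_mono)
    fix k
    have "bst_mean k (\<lambda>s. of_bool (K \<le> size1 s \<and> P_bst s > exp (- h * real (size1 s)))) =
        bst_mean k (\<lambda>s. of_bool (K \<le> k) * of_bool (P_bst s > exp (- h * real k)))"
      by (rule bst_mean_cong) auto
    then show "bst_mean k (\<lambda>s. of_bool (K \<le> size1 s \<and> P_bst s > exp (- h * real (size1 s)))) \<le> p * of_bool (K \<le> k)"
      using p[of k] by (auto simp: bst_mean_cmult)
  qed (use n in auto)
  also have "\<dots> = p * (2 * real n / real K - 1)"
    using assms n by (simp add: additive_mean_cmult additive_mean_large)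
  also have "\<dots> \<le> p * (2 * (real n / real K))"
    using assms by (intro mult_left_mono) auto
  finally show ?thesis .
qed

section \<open>Asymptotics\<close>

text \<open>\<open>4 ^ K n\<close> is at most \<open>n powr (b * ln 4)\<close>, of smaller order
  than \<open>n / ln n\<close> since the exponent is below 1; the other term is asymptotically
  \<open>(2 + \<epsilon>) / b * (n / ln n)\<close>.\<close>

lemma upper_cutoff_asymptotics:
  fixes b \<epsilon> c :: real
  assumes b: "b > 0" "b * ln 4 < 1" and \<epsilon>: "\<epsilon> > 0" and c: "(2 + \<epsilon>) / b < c"
  defines "K \<equiv> \<lambda>n. nat \<lfloor>b * ln (real n)\<rfloor>"
  shows "\<forall>\<^sub>F n in sequentially. 4 ^ K n + (2 + \<epsilon>) * (real n / real (K n)) \<le> c * (real n / ln (real n))"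
    and "\<forall>\<^sub>F n in sequentially. 1 \<le> K n \<and> K n \<le> n"
    and "(\<lambda>n. real (K n) / real n) \<longlonglongrightarrow> 0"
proof -
  have large: "\<forall>\<^sub>F n in sequentially. b * ln (real n) > 2"
    using b by real_asymp
  have K: "b * ln (real n) - 1 \<le> real (K n) \<and> real (K n) \<le> b * ln (real n)" if "b * ln (real n) > 2" for n
    using that unfolding K_def by linarith
  define q where "q = b * ln 4"
  have q: "0 < q" "q < 1" using b by (simp_all add: q_def)
  have "(\<lambda>n. (real n powr q + (2 + \<epsilon>) * (real n / (b * ln (real n) - 1))) / (real n / ln (real n)))
      \<longlonglongrightarrow> (2 + \<epsilon>) / b"
    using q b \<epsilon> by (real_asymp simp: field_simps)
  from order_tendstoD(2)[OF this c] large eventually_gt_at_top[of 2]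
  show "\<forall>\<^sub>F n in sequentially. 4 ^ K n + (2 + \<epsilon>) * (real n / real (K n)) \<le> c * (real n / ln (real n))"
  proof eventually_elim
    case (elim n)
    have "4 ^ K n = 4 powr real (K n)"
      by (simp add: powr_realpow)
    also have "\<dots> \<le> 4 powr (b * ln (real n))"
      using K[OF elim(2)] by (intro powr_mono) auto
    also have "\<dots> = real n powr q"
      using elim by (simp add: powr_def q_def mult_ac)
    finally have "4 ^ K n \<le> real n powr q" .
    moreover have "(2 + \<epsilon>) * (real n / real (K n)) \<le> (2 + \<epsilon>) * (real n / (b * ln (real n) - 1))"
      using K[OF elim(2)] elim \<epsilon> by (intro mult_left_mono divide_left_mono) auto
    moreover have pos: "real n / ln (real n) > 0"
      using elim by simp
    have "real n powr q + (2 + \<epsilon>) * (real n / (b * ln (real n) - 1)) < c * (real n / ln (real n))"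
      using elim(1) unfolding pos_divide_less_eq[OF pos] .
    ultimately show ?case by linarith
  qed
  have "\<forall>\<^sub>F n in sequentially. b * ln (real n) \<le> real n"
    using b by real_asymp
  then show "\<forall>\<^sub>F n in sequentially. 1 \<le> K n \<and> K n \<le> n"
    using large
  proof eventually_elim
    case (elim n)
    then show ?case using K[of n] by linarith
  qed
  show "(\<lambda>n. real (K n) / real n) \<longlonglongrightarrow> 0"
  proof (rule tendsto_sandwich[OF _ _ tendsto_const])
    show "\<forall>\<^sub>F n in sequentially. real (K n) / real n \<le> b * ln (real n) / real n"
      using large by eventually_elim (auto intro!: divide_right_mono dest: K)
    show "(\<lambda>n. b * ln (real n) / real n) \<longlonglongrightarrow> 0"
      by real_asymp
  qed auto
qed

text \<open>The fourth limit compares the bound \<open>n ^ 2 * exp (- h * K n)\<close> on coinciding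
  pairs with \<open>n / K n\<close>. The factor \<open>3 * \<epsilon>\<close> leaves room for three
  errors of size \<open>\<epsilon> * (n / K n)\<close>.\<close>

lemma lower_cutoff_asymptotics:
  fixes g h \<epsilon> c C :: real
  assumes g: "0 < g" "g < h" and c: "0 < c" "c < (2 - 3 * \<epsilon>) * g"
  defines "K \<equiv> \<lambda>n. nat \<lceil>ln (real n) / g\<rceil>"
  shows "\<forall>\<^sub>F n in sequentially. c * (real n / ln (real n)) \<le> (2 - 3 * \<epsilon>) * (real n / real (K n)) - 1"
    and "\<forall>\<^sub>F n in sequentially. 1 \<le> K n \<and> K n \<le> n"
    and "(\<lambda>n. real (K n) / real n) \<longlonglongrightarrow> 0"
    and "(\<lambda>n. C * (real (K n) * real n * exp (- h * real (K n)))) \<longlonglongrightarrow> 0"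
    and "filterlim K at_top sequentially"
proof -
  have large: "\<forall>\<^sub>F n in sequentially. n > 2"
    by (rule eventually_gt_at_top)
  have K: "ln (real n) / g \<le> real (K n) \<and> real (K n) \<le> ln (real n) / g + 1" if "n > 2" for n
  proof -
    have "ln (real n) / g > 0" using that g by simp
    then show ?thesis unfolding K_def by linarith
  qed
  have K0: "real (K n) > 0" if "n > 2" for n
  proof -
    have "ln (real n) / g > 0" using that g by simp
    then show ?thesis using K[OF that] by linarith
  qed
  define e where "e = 2 - 3 * \<epsilon>"
  have e: "e > 0" using c g by (simp add: e_def) (smt (verit) mult_nonpos_nonneg)
  have "(\<lambda>n. (e * (real n / (ln (real n) / g + 1)) - 1) / (real n / ln (real n))) \<longlonglongrightarrow> e * g"
    using g e by (real_asymp simp: field_simps)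
  from order_tendstoD(1)[OF this c(2)[folded e_def]] large
  show "\<forall>\<^sub>F n in sequentially. c * (real n / ln (real n)) \<le> (2 - 3 * \<epsilon>) * (real n / real (K n)) - 1"
    unfolding e_def [symmetric]
  proof eventually_elim
    case (elim n)
    have "e * (real n / (ln (real n) / g + 1)) \<le> e * (real n / real (K n))"
      using K[OF elim(2)] K0[OF elim(2)] e by (intro mult_left_mono divide_left_mono) auto
    moreover have pos: "real n / ln (real n) > 0"
      using elim by simp
    have "c * (real n / ln (real n)) < e * (real n / (ln (real n) / g + 1)) - 1"
      using elim(1) unfolding pos_less_divide_eq[OF pos] .
    ultimately show ?case by linarith
  qed
  have "\<forall>\<^sub>F n in sequentially. ln (real n) / g + 1 \<le> real n"
    using g by real_asymp
  then show "\<forall>\<^sub>F n in sequentially. 1 \<le> K n \<and> K n \<le> n"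
    using large
  proof eventually_elim
    case (elim n)
    then show ?case using K[of n] K0[of n] by linarith
  qed
  show "(\<lambda>n. real (K n) / real n) \<longlonglongrightarrow> 0"
  proof (rule tendsto_sandwich[OF _ _ tendsto_const])
    show "\<forall>\<^sub>F n in sequentially. real (K n) / real n \<le> (ln (real n) / g + 1) / real n"
      using large by eventually_elim (auto intro!: divide_right_mono dest: K)
    show "(\<lambda>n. (ln (real n) / g + 1) / real n) \<longlonglongrightarrow> 0"
      using g by real_asymp
  qed auto
  \<comment> \<open>From \<open>K n \<ge> ln n / g\<close> follows
    \<open>n * exp (- h * K n) \<le> n powr (- q)\<close>, and \<open>g < h\<close> makes
    \<open>q\<close> positive.\<close>
  define q where "q = h / g - 1"
  have q: "q > 0" using g by (simp add: q_def)
  have "(\<lambda>n. real (K n) * real n * exp (- h * real (K n))) \<longlonglongrightarrow> 0"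
  proof (rule tendsto_sandwich[OF _ _ tendsto_const])
    show "\<forall>\<^sub>F n in sequentially. real (K n) * real n * exp (- h * real (K n)) \<le>
        (ln (real n) / g + 1) * real n powr (- q)"
      using large
    proof eventually_elim
      case (elim n)
      have "h * (ln (real n) / g) \<le> h * real (K n)"
        using K[OF elim] g by (intro mult_left_mono) auto
      then have "exp (- h * real (K n)) \<le> exp (- (h / g) * ln (real n))"
        by simp
      also have "\<dots> = real n powr (- (h / g))"
        using elim by (simp add: powr_def)
      finally have "real n * exp (- h * real (K n)) \<le> real n powr 1 * real n powr (- (h / g))"
        by (simp add: mult_left_mono)
      also have "\<dots> = real n powr (- q)"
        unfolding powr_add [symmetric] by (simp add: q_def)
      finally have "real (K n) * (real n * exp (- h * real (K n))) \<le> (ln (real n) / g + 1) * real n powr (- q)"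
        using K[OF elim] by (intro mult_mono) auto
      then show ?case by (simp add: mult.assoc)
    qed
    show "(\<lambda>n. (ln (real n) / g + 1) * real n powr (- q)) \<longlonglongrightarrow> 0"
      using q g by real_asymp
  qed auto
  then show "(\<lambda>n. C * (real (K n) * real n * exp (- h * real (K n)))) \<longlonglongrightarrow> 0"
    by (rule tendsto_mult_right_zero)
  have "filterlim (\<lambda>n. ln (real n) / g) at_top sequentially"
    using g by real_asymp
  then have "filterlim (\<lambda>n. real (K n)) at_top sequentially"
    by (rule filterlim_at_top_mono) (use large in eventually_elim, auto dest: K)
  then show "filterlim K at_top sequentially"
    by (simp add: filterlim_sequentially_iff_filterlim_real)
qed

lemma num_distinct_fringe_upper:
  assumes c: "c > 4 * ln 2"
  shows "\<forall>\<^sub>F n in sequentially. bst_mean n (\<lambda>t. real (num_distinct_fringe t)) \<le> c * (real n / ln (real n))"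
    and "(\<lambda>n. bst_mean n (\<lambda>t. of_bool (real (num_distinct_fringe t) > c * (real n / ln (real n))))) \<longlonglongrightarrow> 0"
proof -
  have "c > 0" using c by (smt (verit) ln_gt_zero)
  then have "2 / c < 1 / (2 * ln 2)"
    using c by (simp add: divide_simps)
  \<comment> \<open>The lower bound on \<open>b\<close> gives \<open>2 / b < c\<close>, the upper
    one \<open>b * ln 4 < 1\<close>; \<open>c > 4 * ln 2\<close> leaves a gap between them.\<close>
  then obtain b where b: "2 / c < b" "b < 1 / (2 * ln 2)"
    using dense by blast
  have b0: "b > 0" using b(1) \<open>c > 0\<close> by (smt (verit) divide_pos_pos)
  have "ln (4 :: real) = 2 * ln 2"
    using ln_realpow[of 2 2] by simp
  then have b4: "b * ln 4 < 1"
    using b(2) by (simp add: field_simps)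
  have "2 / b < c" using b(1) b0 \<open>c > 0\<close> by (simp add: field_simps)
  \<comment> \<open>This makes \<open>(2 + \<epsilon>) / b\<close> the midpoint of
    \<open>2 / b\<close> and \<open>c\<close>.\<close>
  define \<epsilon> where "\<epsilon> = (c * b - 2) / 2"
  have \<epsilon>: "\<epsilon> > 0" "(2 + \<epsilon>) / b < c"
    using \<open>2 / b < c\<close> b0 by (simp_all add: \<epsilon>_def field_simps)
  define K where "K n = nat \<lfloor>b * ln (real n)\<rfloor>" for n
  note aux = upper_cutoff_asymptotics[OF b0 b4 \<epsilon>, folded K_def]
  show "\<forall>\<^sub>F n in sequentially. bst_mean n (\<lambda>t. real (num_distinct_fringe t)) \<le> c * (real n / ln (real n))"
    using aux(1,2)
  proof eventually_elim
    case (elim n)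
    have "bst_mean n (\<lambda>t. real (num_distinct_fringe t)) \<le> bst_mean n (\<lambda>t. 4 ^ K n + num_large_fringe (K n) t)"
      by (intro bst_mean_mono num_distinct_fringe_le)
    also have "\<dots> = 4 ^ K n + (2 * real n / real (K n) - 1)"
      using elim by (simp add: bst_mean_add bst_mean_const bst_mean_num_large)
    also have "\<dots> \<le> 4 ^ K n + (2 + \<epsilon>) * (real n / real (K n))"
    proof -
      have "(2 + \<epsilon>) * (real n / real (K n)) = 2 * real n / real (K n) + \<epsilon> * (real n / real (K n))"
        by (simp add: distrib_right add_divide_distrib)
      moreover have "\<epsilon> * (real n / real (K n)) \<ge> 0"
        using \<epsilon> by simp
      ultimately show ?thesis by linarith
    qed
    finally show ?case using elim by linarith
  qed
  show "(\<lambda>n. bst_mean n (\<lambda>t. of_bool (real (num_distinct_fringe t) > c * (real n / ln (real n))))) \<longlonglongrightarrow> 0"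
  proof (rule tendsto_sandwich[OF _ _ tendsto_const])
    show "(\<lambda>n. 8 / \<epsilon> ^ 2 * (real (K n) / real n)) \<longlonglongrightarrow> 0"
      using tendsto_mult_right_zero[OF aux(3)] .
    show "\<forall>\<^sub>F n in sequentially.
        bst_mean n (\<lambda>t. of_bool (real (num_distinct_fringe t) > c * (real n / ln (real n)))) \<le> 8 / \<epsilon> ^ 2 * (real (K n) / real n)"
      using aux(1,2)
    proof eventually_elim
      case (elim n)
      let ?Z = "num_large_fringe (K n)" and ?a = "real n / real (K n)"
      have "bst_mean n (\<lambda>t. of_bool (real (num_distinct_fringe t) > c * (real n / ln (real n)))) \<le>
          bst_mean n (\<lambda>t. of_bool (\<bar>?Z t - (2 * real n / real (K n) - 1)\<bar> \<ge> \<epsilon> * ?a))"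
      proof (rule bst_mean_mono)
        fix t :: "unit tree"
        have "real (num_distinct_fringe t) \<le> 4 ^ K n + ?Z t"
          by (rule num_distinct_fringe_le)
        moreover have "(2 + \<epsilon>) * ?a = 2 * real n / real (K n) + \<epsilon> * ?a"
          by (simp add: distrib_right add_divide_distrib)
        ultimately show "of_bool (real (num_distinct_fringe t) > c * (real n / ln (real n))) \<le>
            (of_bool (\<bar>?Z t - (2 * real n / real (K n) - 1)\<bar> \<ge> \<epsilon> * ?a) :: real)"
          using elim(1) by auto
      qed
      also have "\<dots> \<le> 8 / \<epsilon> ^ 2 * (real (K n) / real n)"
        using elim \<epsilon> by (intro prob_num_large_deviation) auto
      finally show ?case .
    qed
  qed (auto intro!: always_eventually bst_mean_nonneg)
qed

text \<open>Too few distinct subtrees force one of three events: few large fringe subtrees, many bad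
  ones, or many coinciding pairs of good ones. Chebyshev's inequality handles the first, Markov's
  the other two.\<close>

lemma num_distinct_fringe_lower:
  assumes c: "0 < c" "c < 2 * truncated_entropy M"
  shows "(\<lambda>n. bst_mean n (\<lambda>t. of_bool (real (num_distinct_fringe t) < c * (real n / ln (real n))))) \<longlonglongrightarrow> 0"
proof -
  \<comment> \<open>\<open>h < truncated_entropy M\<close> makes bad trees rare,
    \<open>g < h\<close> makes coinciding pairs rare, and \<open>c / 2 < g\<close> leaves room for
    \<open>\<epsilon>\<close>.\<close>
  obtain h where h: "c / 2 < h" "h < truncated_entropy M"
    using dense[of "c / 2" "truncated_entropy M"] c by auto
  obtain g where g: "c / 2 < g" "g < h"
    using dense[OF h(1)] by auto
  have g0: "g > 0" and h0: "h > 0" using g c by auto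
  \<comment> \<open>Then \<open>(2 - 3 * \<epsilon>) * g = c + \<epsilon> * g\<close>.\<close>
  define \<epsilon> where "\<epsilon> = (2 - c / g) / 4"
  have \<epsilon>: "\<epsilon> > 0" "c < (2 - 3 * \<epsilon>) * g"
    using g g0 by (simp_all add: \<epsilon>_def field_simps)
  define C where "C = 1 / (\<epsilon> * (1 - exp (- h)))"
  define K where "K n = nat \<lceil>ln (real n) / g\<rceil>" for n
  note aux = lower_cutoff_asymptotics[OF g0 g(2) c(1) \<epsilon>(2), folded K_def]
  let ?J = "\<lambda>n. bst_mean n (\<lambda>t. of_bool (real (num_distinct_fringe t) < c * (real n / ln (real n))))"
  show ?thesis
  proof (rule order_tendstoI)
    fix a :: real assume "a < 0"
    moreover have "0 \<le> ?J n" for n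
      by (intro bst_mean_nonneg) auto
    ultimately show "\<forall>\<^sub>F n in sequentially. a < ?J n"
      by (intro always_eventually allI) (rule less_le_trans)
  next
    fix a :: real assume a: "a > 0"
    \<comment> \<open>Markov's inequality turns \<open>p\<close> into the bound
      \<open>2 * p / \<epsilon> = a / 2\<close> for the second event.\<close>
    define p where "p = a * \<epsilon> / 4"
    have p: "p > 0" using a \<epsilon> by (simp add: p_def)
    have "\<forall>\<^sub>F k in sequentially. bst_mean k (\<lambda>t. of_bool (P_bst t > exp (- h * real k))) < p"
      using order_tendstoD(2)[OF prob_P_bst_large[OF h(2)] p] .
    then obtain k0 where k0: "\<And>k. k \<ge> k0 \<Longrightarrow> bst_mean k (\<lambda>t. of_bool (P_bst t > exp (- h * real k))) \<le> p"
      unfolding eventually_sequentially by (meson less_imp_le)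
    have "\<forall>\<^sub>F n in sequentially. K n \<ge> k0"
      using aux(5) by (simp add: filterlim_at_top)
    moreover have "\<forall>\<^sub>F n in sequentially. 8 / \<epsilon> ^ 2 * (real (K n) / real n) < a / 4"
      by (rule order_tendstoD(2)[OF tendsto_mult_right_zero[OF aux(3)]]) (use a in simp)
    moreover have "\<forall>\<^sub>F n in sequentially. C * (real (K n) * real n * exp (- h * real (K n))) < a / 4"
      by (rule order_tendstoD(2)[OF aux(4)]) (use a in simp)
    ultimately show "\<forall>\<^sub>F n in sequentially. ?J n < a"
      using aux(1,2)
    proof eventually_elim
      case (elim n)
      let ?Z = "num_large_fringe (K n)" and ?a = "real n / real (K n)"
      let ?B = "num_bad_fringe h (K n)"
      let ?Q = "\<lambda>t. \<Sum>s\<in>good_trees h (K n) n. occurrences s t * (occurrences s t - 1)"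
      let ?p1 = "bst_mean n (\<lambda>t. of_bool (\<bar>?Z t - (2 * real n / real (K n) - 1)\<bar> \<ge> \<epsilon> * ?a))"
      let ?p2 = "bst_mean n (\<lambda>t. of_bool (?B t \<ge> \<epsilon> * ?a))"
      let ?p3 = "bst_mean n (\<lambda>t. of_bool (?Q t \<ge> \<epsilon> * ?a))"
      have K: "K n \<ge> 1" "n \<ge> K n" "n \<ge> 1" using elim by auto
      have a0: "\<epsilon> * ?a > 0" using K \<epsilon> by simp
      have "?J n \<le> bst_mean n (\<lambda>t. of_bool (\<bar>?Z t - (2 * real n / real (K n) - 1)\<bar> \<ge> \<epsilon> * ?a) +
          of_bool (?B t \<ge> \<epsilon> * ?a) + of_bool (?Q t \<ge> \<epsilon> * ?a))"
      proof (rule bst_mean_mono)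
        fix t :: "unit tree" assume t: "size1 t = n"
        have "real (num_distinct_fringe t) \<ge> ?Z t - ?B t - ?Q t"
          by (rule num_distinct_fringe_ge_large[OF t])
        moreover have "(2 - 3 * \<epsilon>) * ?a = 2 * real n / real (K n) - 3 * (\<epsilon> * ?a)"
          by (simp add: left_diff_distrib diff_divide_distrib)
        ultimately have "\<bar>?Z t - (2 * real n / real (K n) - 1)\<bar> \<ge> \<epsilon> * ?a \<or> ?B t \<ge> \<epsilon> * ?a \<or> ?Q t \<ge> \<epsilon> * ?a"
          if "real (num_distinct_fringe t) < c * (real n / ln (real n))"
          using elim(4) that by argo
        then show "of_bool (real (num_distinct_fringe t) < c * (real n / ln (real n))) \<le>
          (of_bool (\<bar>?Z t - (2 * real n / real (K n) - 1)\<bar> \<ge> \<epsilon> * ?a) +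
          of_bool (?B t \<ge> \<epsilon> * ?a) + of_bool (?Q t \<ge> \<epsilon> * ?a) :: real)"
          by (auto simp del: abs_le_iff)
      qed
      also have "\<dots> = ?p1 + ?p2 + ?p3"
        by (simp only: bst_mean_add)
      also have "?p1 < a / 4"
        using prob_num_large_deviation[OF K(1,2) \<epsilon>(1)] elim(2) by linarith
      \<comment> \<open>The three bounds add up to \<open>a\<close>; strictness comes from the one
        for \<open>?p1\<close>.\<close>
      also have "?p2 \<le> a / 2"
      proof -
        have "?p2 \<le> bst_mean n ?B / (\<epsilon> * ?a)"
          using a0 by (intro bst_mean_Markov) (auto simp: num_bad_fringe_def intro!: fringe_sum_nonneg)
        also have "\<dots> \<le> p * (2 * ?a) / (\<epsilon> * ?a)"
          using a0 K p k0 elim(1) by (intro divide_right_mono bst_mean_num_bad_le) auto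
        also have "\<dots> = a / 2"
          using K \<epsilon> by (simp add: p_def field_simps)
        finally show ?thesis .
      qed
      also have "?p3 \<le> a / 4"
      proof -
        have "occurrences s t * (occurrences s t - 1) \<ge> 0" for s t
          unfolding occurrences_eq_count by (cases "count (fringe_subtrees t) s") auto
        then have "?p3 \<le> bst_mean n ?Q / (\<epsilon> * ?a)"
          using a0 by (intro bst_mean_Markov) (auto intro!: sum_nonneg)
        also have "\<dots> \<le> real n ^ 2 * (exp (- h * real (K n)) / (1 - exp (- h))) / (\<epsilon> * ?a)"
          using a0 K h0 by (intro divide_right_mono bst_mean_good_pairs_le) auto
        also have "\<dots> = C * (real (K n) * real n * exp (- h * real (K n)))"
          using K \<epsilon> by (simp add: C_def power2_eq_square mult_ac)
        also have "\<dots> \<le> a / 4" using elim(3) by simp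
        finally show ?thesis .
      qed
      finally show ?case by simp
    qed
  qed
qed

theorem theorem4:
  shows "\<exists>c5 c6 :: real.
    \<bar>c5 - 2.4071298335\<bar> \<le> 5 / 10 ^ 11 \<and>
    \<bar>c6 - 2.7725887222\<bar> \<le> 5 / 10 ^ 11 \<and>
    (\<exists>\<epsilon> \<delta> :: nat \<Rightarrow> real. \<epsilon> \<in> o(\<lambda>_. 1) \<and> \<delta> \<in> o(\<lambda>_. 1) \<and>
      (\<forall>\<^sub>F n in sequentially.
        c5 * (real n / ln (real n)) * (1 + \<epsilon> n)
          \<le> measure_pmf.expectation (random_bst n) (\<lambda>t. real (num_distinct_fringe t)) \<and>
        measure_pmf.expectation (random_bst n) (\<lambda>t. real (num_distinct_fringe t))
          \<le> c6 * (real n / ln (real n)) * (1 + \<delta> n))) \<and>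
    (\<forall>\<eta> > 0.
      (\<lambda>n. measure_pmf.prob (random_bst n)
        {t. (c5 - \<eta>) * (real n / ln (real n)) \<le> real (num_distinct_fringe t) \<and>
            real (num_distinct_fringe t) \<le> (c6 + \<eta>) * (real n / ln (real n))})
      \<longlonglongrightarrow> 1)"
proof -
  \<comment> \<open>\<open>c5\<close> and \<open>c6\<close> are taken at the ends of the admissible intervals, strictly below \<open>2 h\<close> and strictly
    above \<open>4 ln 2\<close>, so that the error terms can be chosen to be zero.\<close>
  define c5 c6 :: real where "c5 = 2.40712983345" and "c6 = 2.77258872225"
  let ?J = "\<lambda>t. real (num_distinct_fringe t)"
  obtain M where M: "c5 / 2 < truncated_entropy M"
    using truncated_entropy_gt by (auto simp: c5_def)
  have c5: "0 < c5" "c5 < 2 * truncated_entropy M"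
    using M by (simp_all add: c5_def)
  \<comment> \<open>The gap between \<open>c5\<close> and \<open>c\<close> absorbs the factor
    \<open>1 - p n\<close>, where \<open>p n\<close> tends to 0, in the passage from probability to
    expectation.\<close>
  obtain c where c: "c5 < c" "c < 2 * truncated_entropy M"
    using dense[OF c5(2)] by auto
  have c6: "c6 > 4 * ln 2"
    using four_ln_2_less by (simp add: c6_def)
  note lower = num_distinct_fringe_lower[OF c5]
  note upper = num_distinct_fringe_upper[OF c6]

  have expectation_lower: "\<forall>\<^sub>F n in sequentially. c5 * (real n / ln (real n)) \<le> bst_mean n ?J"
  proof -
    define p where "p n = bst_mean n (\<lambda>t. of_bool (?J t < c * (real n / ln (real n))))" for n
    have "p \<longlonglongrightarrow> 0"
      unfolding p_def using c c5 by (intro num_distinct_fringe_lower[where M = M]) auto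
    then have "(\<lambda>n. c * (1 - p n)) \<longlonglongrightarrow> c * (1 - 0)"
      by (intro tendsto_intros)
    then have "\<forall>\<^sub>F n in sequentially. c5 < c * (1 - p n)"
      using c by (intro order_tendstoD) auto
    then show ?thesis
      using eventually_gt_at_top[of 1]
    proof eventually_elim
      case (elim n)
      let ?r = "real n / ln (real n)"
      have r: "?r > 0" using elim by simp
      have "c5 * ?r \<le> (c * (1 - p n)) * ?r"
        using elim r by (intro mult_right_mono) auto
      also have "\<dots> = bst_mean n (\<lambda>t. c * ?r * (1 - of_bool (?J t < c * ?r)))"
        using elim by (simp only: bst_mean_cmult bst_mean_diff p_def) (simp add: bst_mean_const)
      also have "\<dots> \<le> bst_mean n ?J"
        by (intro bst_mean_mono) auto
      finally show ?case .
    qed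
  qed

  have whp: "(\<lambda>n. measure_pmf.prob (random_bst n)
        {t. (c5 - \<eta>) * (real n / ln (real n)) \<le> ?J t \<and> ?J t \<le> (c6 + \<eta>) * (real n / ln (real n))})
      \<longlonglongrightarrow> 1" (is "?P \<longlonglongrightarrow> 1") if \<eta>: "\<eta> > 0" for \<eta>
  proof (rule tendsto_sandwich[OF _ _ _ tendsto_const])
    \<comment> \<open>By the union bound, the two failure probabilities \<open>?p n\<close> and
      \<open>?q n\<close> squeeze the probability between \<open>1 - ?p n - ?q n\<close> and
      1.\<close>
    let ?p = "\<lambda>n. bst_mean n (\<lambda>t. of_bool (?J t < c5 * (real n / ln (real n))))"
    let ?q = "\<lambda>n. bst_mean n (\<lambda>t. of_bool (?J t > c6 * (real n / ln (real n))))"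
    have "(\<lambda>n. 1 - ?p n - ?q n) \<longlonglongrightarrow> 1 - 0 - 0"
      by (intro tendsto_intros lower upper(2))
    then show "(\<lambda>n. 1 - ?p n - ?q n) \<longlonglongrightarrow> 1" by simp
    show "\<forall>\<^sub>F n in sequentially. 1 - ?p n - ?q n \<le> ?P n"
      using eventually_gt_at_top[of 1]
    proof eventually_elim
      case (elim n)
      let ?r = "real n / ln (real n)"
      have r: "?r > 0" using elim by simp
      have "1 - ?p n - ?q n = bst_mean n (\<lambda>t. 1 - of_bool (?J t < c5 * ?r) - of_bool (?J t > c6 * ?r))"
        using elim by (simp only: bst_mean_diff) (simp add: bst_mean_const)
      also have "\<dots> \<le> bst_mean n (\<lambda>t. of_bool ((c5 - \<eta>) * ?r \<le> ?J t \<and> ?J t \<le> (c6 + \<eta>) * ?r))"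
      proof (rule bst_mean_mono)
        fix t :: "unit tree"
        have "(c5 - \<eta>) * ?r \<le> c5 * ?r" "c6 * ?r \<le> (c6 + \<eta>) * ?r"
          using r \<eta> by (intro mult_right_mono; simp)+
        then show "1 - of_bool (?J t < c5 * ?r) - of_bool (?J t > c6 * ?r) \<le>
            (of_bool ((c5 - \<eta>) * ?r \<le> ?J t \<and> ?J t \<le> (c6 + \<eta>) * ?r) :: real)"
          unfolding of_bool_def by (auto simp only: split: if_splits)
      qed
      also have "\<dots> = ?P n"
        using elim by (simp add: prob_random_bst)
      finally show ?case .
    qed
  qed (auto intro!: always_eventually)

  show ?thesis
  proof (rule exI[of _ c5], rule exI[of _ c6], intro conjI allI impI)
    show "\<exists>\<epsilon> \<delta> :: nat \<Rightarrow> real. \<epsilon> \<in> o(\<lambda>_. 1) \<and> \<delta> \<in> o(\<lambda>_. 1) \<and>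
      (\<forall>\<^sub>F n in sequentially.
        c5 * (real n / ln (real n)) * (1 + \<epsilon> n) \<le> measure_pmf.expectation (random_bst n) ?J \<and>
        measure_pmf.expectation (random_bst n) ?J \<le> c6 * (real n / ln (real n)) * (1 + \<delta> n))"
    proof (intro exI[of _ "\<lambda>_. 0"] conjI)
      show "\<forall>\<^sub>F n in sequentially.
          c5 * (real n / ln (real n)) * (1 + 0) \<le> measure_pmf.expectation (random_bst n) ?J \<and>
          measure_pmf.expectation (random_bst n) ?J \<le> c6 * (real n / ln (real n)) * (1 + 0)"
        using expectation_lower upper(1) eventually_ge_at_top[of 1]
        by eventually_elim (simp add: expectation_random_bst)
    qed auto
  qed (use whp in \<open>auto simp: c5_def c6_def\<close>)
qed

end
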